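(* Let $\lambda\ge 0$, $0\le\alpha<1$, $0\le k<\infty$, $u\in\mathbb{N}=\{1,2,3,\dots\}$, $v\in\mathbb{N}_0=\mathbb{N}\cup\{0\}$ with $u>v$. The family $k\text{-}UTH(u,v,\alpha,\lambda)$ is closed under convex combination; that is, if $f_{u,j}\in k\text{-}UTH(u,v,\alpha,\lambda)$ for $j=1,2,3,\dots$ and $0\le t_j\le1$ with $\sum_{j=1}^\infty t_j=1$, then $\sum_{j=1}^\infty t_jf_{u,j}\in k\text{-}UTH(u,v,\alpha,\lambda)$.
   Context: $U=\{z\in\mathbb{C}:|z|<1\}$. $SH$ is the class of functions $f=h+\overline{g}$ ($h,g$ analytic in $U$) that are harmonic, univalent and sense-preserving in $U$ with $f(0)=0$, $f_z(0)=1$; $h$ and $g$ are written $h(z)=z+\sum_{n\ge2}a_nz^n$, $g(z)=\sum_{n\ge1}b_nz^n$, $|b_1|<1$. Al-Oboudi operator: for $\lambda\ge0$ and $u\in\mathbb{N}_0$, $D^uh(z)=z+\sum_{n=2}^\infty[1+(n-1)\lambda]^ua_nz^n$, $D^ug(z)=\sum_{n=1}^\infty[1+(n-1)\lambda]^ub_nz^n$, and $D^uf(z)=D^uh(z)+(-1)^u\overline{D^ug(z)}$. For $0\le\alpha<1$, $0\le k<\infty$, $u\in\mathbb{N}$, $v\in\mathbb{N}_0$, $u>v$, $\lambda\ge0$, the class $k\text{-}USH(u,v,\alpha,\lambda)$ consists of the functions $f=h+\overline{g}\in SH$ satisfying $$\operatorname{Re}\left\{(1+ke^{i\phi})\frac{D^uf(z)}{D^vf(z)}-ke^{i\phi}\right\}\ge\alpha$$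 for all $z\in U\setminus\{0\}$ and all real $\phi$. The subclass $k\text{-}UTH(u,v,\alpha,\lambda)$ of $k\text{-}USH(u,v,\alpha,\lambda)$ consists of those members of the form $f_u=h+\overline{g_u}$ with $h(z)=z-\sum_{n\ge2}|a_n|z^n$, $g_u(z)=(-1)^{u-1}\sum_{n\ge1}|b_n|z^n$, $|b_1|<1$. *)

theory Defs
  imports "HOL-Complex_Analysis.Complex_Analysis"
begin

text \<open>
  Throughout, the open unit disc is \<open>ball 0 1 :: complex set\<close>.  Functions on the disc are
  modelled by total functions \<open>complex \<Rightarrow> complex\<close>; every notion below depends only on
  their values inside the disc.
\<close>

definition wirtinger_z :: "(complex \<Rightarrow> complex) \<Rightarrow> complex \<Rightarrow> complex" where
  "wirtinger_z f z =
     (frechet_derivative f (at z) 1 - \<i> * frechet_derivative f (at z) \<i>) / 2"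

definition wirtinger_zbar :: "(complex \<Rightarrow> complex) \<Rightarrow> complex \<Rightarrow> complex" where
  "wirtinger_zbar f z =
     (frechet_derivative f (at z) 1 + \<i> * frechet_derivative f (at z) \<i>) / 2"

text \<open>
  Sense-preserving means positive Jacobian, and the Jacobian of \<open>f\<close> is
  $|f_z|^2 - |f_{\bar z}|^2$.
\<close>

definition sense_preserving_on :: "(complex \<Rightarrow> complex) \<Rightarrow> complex set \<Rightarrow> bool" where
  "sense_preserving_on f S \<longleftrightarrow>
     (\<forall>z\<in>S. (cmod (wirtinger_z f z))\<^sup>2 - (cmod (wirtinger_zbar f z))\<^sup>2 > 0)"

text \<open>
  The representation $f = h + \overline{g}$ of a harmonic function on the disc.  The power series
  of \<open>g\<close> has no constant term; this makes \<open>h\<close> and \<open>g\<close> unique on the disc.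
\<close>

definition harmonic_decomp ::
  "(complex \<Rightarrow> complex) \<Rightarrow> (complex \<Rightarrow> complex) \<Rightarrow> (complex \<Rightarrow> complex) \<Rightarrow> bool" where
  "harmonic_decomp f h g \<longleftrightarrow>
     h holomorphic_on ball 0 1 \<and> g holomorphic_on ball 0 1 \<and> g 0 = 0 \<and>
     (\<forall>z\<in>ball 0 1. f z = h z + cnj (g z))"

definition taylor_coeff :: "(complex \<Rightarrow> complex) \<Rightarrow> nat \<Rightarrow> complex" where
  "taylor_coeff h n = (deriv ^^ n) h 0 / fact n"

text \<open>
  The normalisation $h(z) = z + \sum_{n\ge 2} a_n z^n$ amounts to \<open>f 0 = 0\<close>,
  $f_z(0) = 1$ and \<open>g 0 = 0\<close>.
\<close>

definition SH :: "(complex \<Rightarrow> complex) set" where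
  "SH = {f. (\<exists>h g. harmonic_decomp f h g \<and> cmod (taylor_coeff g 1) < 1) \<and>
            inj_on f (ball 0 1) \<and> sense_preserving_on f (ball 0 1) \<and>
            f 0 = 0 \<and> wirtinger_z f 0 = 1}"

text \<open>
  The summand with index \<open>n\<close> is the one of $z^{n+1}$.  The same formula serves for \<open>h\<close>
  (where the coefficient of $z$ is 1) and for \<open>g\<close>.
\<close>

definition al_oboudi :: "real \<Rightarrow> nat \<Rightarrow> (complex \<Rightarrow> complex) \<Rightarrow> complex \<Rightarrow> complex" where
  "al_oboudi lam u h z =
     (\<Sum>n. of_real ((1 + real n * lam) ^ u) * taylor_coeff h (n + 1) * z ^ (n + 1))"

definition al_oboudi_harmonic ::
  "real \<Rightarrow> nat \<Rightarrow> (complex \<Rightarrow> complex) \<Rightarrow> (complex \<Rightarrow> complex) \<Rightarrow> complex \<Rightarrow> complex" where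
  "al_oboudi_harmonic lam u h g z =
     al_oboudi lam u h z + (-1) ^ u * cnj (al_oboudi lam u g z)"

text \<open>
  Since \<open>x / 0 = 0\<close> in HOL, the requirement that the quotient be defined is stated explicitly.
\<close>

definition k_USH :: "real \<Rightarrow> nat \<Rightarrow> nat \<Rightarrow> real \<Rightarrow> real \<Rightarrow> (complex \<Rightarrow> complex) set" where
  "k_USH k u v \<alpha> lam =
     {f \<in> SH. \<exists>h g. harmonic_decomp f h g \<and>
        (\<forall>z\<in>ball 0 1 - {0}.
           al_oboudi_harmonic lam v h g z \<noteq> 0 \<and>
           (\<forall>\<phi>::real.
              Re ((1 + of_real k * cis \<phi>) *
                    (al_oboudi_harmonic lam u h g z / al_oboudi_harmonic lam v h g z)
                  - of_real k * cis \<phi>) \<ge> \<alpha>))}"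

definition k_UTH :: "real \<Rightarrow> nat \<Rightarrow> nat \<Rightarrow> real \<Rightarrow> real \<Rightarrow> (complex \<Rightarrow> complex) set" where
  "k_UTH k u v \<alpha> lam =
     {f \<in> k_USH k u v \<alpha> lam. \<exists>h g. harmonic_decomp f h g \<and>
        (\<exists>(a :: nat \<Rightarrow> complex) (b :: nat \<Rightarrow> complex). cmod (b 1) < 1 \<and>
           (\<forall>z\<in>ball 0 1.
              summable (\<lambda>n. of_real (cmod (a (n + 2))) * z ^ (n + 2)) \<and>
              h z = z - (\<Sum>n. of_real (cmod (a (n + 2))) * z ^ (n + 2)) \<and>
              summable (\<lambda>n. of_real (cmod (b (n + 1))) * z ^ (n + 1)) \<and>
              g z = (-1) ^ (u - 1) * (\<Sum>n. of_real (cmod (b (n + 1))) * z ^ (n + 1))))}"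

end

theory Submission
  imports Defs
begin

text \<open>
  The family is cut out by linear inequalities on the moduli of the Taylor coefficients, and linear
  inequalities are stable under (infinite) convex combinations.

  Write $p_n = |a_{n+1}|$ for $n \<ge> 1$, \<open>p 0 = 0\<close>, $q_n = |b_{n+1}|$ and $c_n = 1 + n\lambda$.  A function
  of the form prescribed in \<^const>\<open>k_UTH\<close> belongs to the family if and only if \<open>q 0 < 1\<close>,
  $$\sum_n (n+1)(p_n + q_n) \<le> 1 \qquad\mbox{and}\qquad \sum_n (A_n p_n + B_n q_n) \<le> 1 - \alpha,$$
  where $A_n = (1+k) c_n^u - (k+\alpha) c_n^v$ and $B_n = (1+k) c_n^u - (-1)^{u+v} (k+\alpha) c_n^v$.
  The first inequality corresponds to membership in \<^const>\<open>SH\<close>, the second one to the condition on the ratio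
  of $D^u f$ and $D^v f$.

  Both inequalities are necessary because on the positive real axis all power series involved are
  real: there the Jacobian condition and the ratio condition with $\phi = 0$ are inequalities
  between real power series, and \<open>r\<close> can tend to 1 (\<open>SH_neg_harmonic_partial_sums\<close> and
  \<open>coeffs_of_ratio_condition\<close>).  They are sufficient by the triangle inequality: the leading term \<open>z\<close>
  dominates the increments of the other terms (\<open>neg_harmonic_in_SH\<close>), and the half plane
  $\mathrm{Re}\, W \<ge> \alpha$ is the set of all \<open>W\<close> with $|W - 1| \<le> |W + 1 - 2\alpha|$, which turns the ratio condition into a
  comparison of two norms (\<open>ratio_condition_of_coeffs\<close>).

  For a convex combination the coefficient moduli are averaged with the weights \<open>t\<close>, by an exchange of
  summations (\<open>neg_harmonic_convex_sums\<close>), and the inequalities are averaged too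
  (\<open>coeff_bounds_convex\<close>).
\<close>

section \<open>Power series on the unit disc\<close>

text \<open>
  The condition says that \<open>c\<close> is the coefficient sequence of a power series with radius of convergence
  at least 1.  Absolute values make it immediately stable under domination.
\<close>

definition disc_convergent :: "(nat \<Rightarrow> real) \<Rightarrow> bool" where
  "disc_convergent c \<longleftrightarrow> (\<forall>r. 0 \<le> r \<and> r < 1 \<longrightarrow> summable (\<lambda>n. \<bar>c n\<bar> * r ^ n))"

text \<open>
  Index \<open>n\<close> carries the coefficient of $z^{n+1}$, the convention of \<^const>\<open>al_oboudi\<close>; so multiplying
  the coefficient with index \<open>n\<close> by $(1+n\lambda)^m$ is exactly the operator $D^m$, and multiplying it
  by $n+1$ gives the coefficient of $z^n$ in the derivative.
\<close>

definition shifted_series :: "(nat \<Rightarrow> real) \<Rightarrow> complex \<Rightarrow> complex" where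
  "shifted_series c z = (\<Sum>n. of_real (c n) * z ^ (n + 1))"

lemma disc_convergentD:
  "disc_convergent c \<Longrightarrow> 0 \<le> r \<Longrightarrow> r < 1 \<Longrightarrow> summable (\<lambda>n. \<bar>c n\<bar> * r ^ n)"
  by (simp add: disc_convergent_def)

lemma disc_convergent_mono:
  assumes "disc_convergent c" "\<And>n. \<bar>d n\<bar> \<le> \<bar>c n\<bar>"
  shows "disc_convergent d"
  unfolding disc_convergent_def
proof (intro allI impI)
  fix r :: real assume r: "0 \<le> r \<and> r < 1"
  show "summable (\<lambda>n. \<bar>d n\<bar> * r ^ n)"
    by (rule summable_comparison_test'[OF disc_convergentD[OF assms(1), of r], of 0])
       (use r assms(2) in \<open>auto simp: abs_mult intro!: mult_right_mono\<close>)
qed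

lemma disc_convergent_add:
  assumes "disc_convergent c" "disc_convergent d"
  shows "disc_convergent (\<lambda>n. c n + d n)"
  unfolding disc_convergent_def
proof (intro allI impI)
  fix r :: real assume r: "0 \<le> r \<and> r < 1"
  have "summable (\<lambda>n. \<bar>c n\<bar> * r ^ n + \<bar>d n\<bar> * r ^ n)"
    using r assms by (intro summable_add disc_convergentD) auto
  thus "summable (\<lambda>n. \<bar>c n + d n\<bar> * r ^ n)"
    by (rule summable_comparison_test'[where N = 0])
       (use r in \<open>auto simp: abs_mult simp flip: distrib_right intro!: mult_right_mono\<close>)
qed

lemma disc_convergent_cmult:
  assumes "disc_convergent c"
  shows "disc_convergent (\<lambda>n. x * c n)"
  unfolding disc_convergent_def
  using summable_mult[OF disc_convergentD[OF assms], of _ "\<bar>x\<bar>"]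
  by (auto simp: abs_mult mult.assoc)

lemma disc_convergent_diff:
  assumes "disc_convergent c" "disc_convergent d"
  shows "disc_convergent (\<lambda>n. c n - d n)"
  using disc_convergent_add[OF assms(1) disc_convergent_cmult[OF assms(2), of "-1"]] by simp

lemma disc_convergent_bounded:
  assumes "\<And>n. \<bar>c n\<bar> \<le> 1"
  shows "disc_convergent c"
proof (rule disc_convergent_mono)
  show "disc_convergent (\<lambda>_. 1)"
    by (auto simp: disc_convergent_def intro!: summable_geometric)
qed (use assms in auto)

text \<open>
  A weight that grows linearly is absorbed by passing from \<open>r\<close> to a slightly larger radius \<open>R\<close>, since
  $n (r/R)^n$ tends to 0.
\<close>

lemma disc_convergent_linear_weight:
  assumes "disc_convergent c"
  shows "disc_convergent (\<lambda>n. (1 + real n * lam) * c n)"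
  unfolding disc_convergent_def
proof (intro allI impI)
  fix r :: real assume r: "0 \<le> r \<and> r < 1"
  \<comment> \<open>Any radius strictly between r and 1 will do.\<close>
  define R where "R = (1 + r) / 2"
  have R: "r < R" "0 < R" "R < 1" using r by (auto simp: R_def)
  define x where "x = r / R"
  have x: "0 \<le> x" "x < 1" using r R by (auto simp: x_def)
  have "(\<lambda>n. x ^ n + lam * (of_nat n * x ^ n)) \<longlonglongrightarrow> 0 + lam * 0"
    using x by (intro tendsto_intros LIMSEQ_power_zero powser_times_n_limit_0) auto
  hence "Bseq (\<lambda>n. x ^ n + lam * (of_nat n * x ^ n))"
    by (intro convergent_imp_Bseq convergentI)
  then obtain K where K: "\<And>n. norm (x ^ n + lam * (of_nat n * x ^ n)) \<le> K"
    unfolding Bseq_def by blast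
  have "summable (\<lambda>n. K * (\<bar>c n\<bar> * R ^ n))"
    using R assms by (intro summable_mult disc_convergentD) auto
  thus "summable (\<lambda>n. \<bar>(1 + real n * lam) * c n\<bar> * r ^ n)"
  proof (rule summable_comparison_test'[where N = 0])
    fix n :: nat
    have r_eq: "r ^ n = x ^ n * R ^ n"
      using R by (simp add: x_def power_divide)
    have "norm (\<bar>(1 + real n * lam) * c n\<bar> * r ^ n) = \<bar>(1 + real n * lam) * x ^ n\<bar> * (\<bar>c n\<bar> * R ^ n)"
      using x R by (simp add: r_eq abs_mult)
    also have "(1 + real n * lam) * x ^ n = x ^ n + lam * (of_nat n * x ^ n)"
      by (simp add: algebra_simps)
    also have "\<bar>x ^ n + lam * (of_nat n * x ^ n)\<bar> * (\<bar>c n\<bar> * R ^ n) \<le> K * (\<bar>c n\<bar> * R ^ n)"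
      using K[of n] R by (intro mult_right_mono) auto
    finally show "norm (\<bar>(1 + real n * lam) * c n\<bar> * r ^ n) \<le> K * (\<bar>c n\<bar> * R ^ n)" .
  qed
qed

lemma disc_convergent_weighted:
  assumes "disc_convergent c"
  shows "disc_convergent (\<lambda>n. (1 + real n * lam) ^ m * c n)"
proof (induction m)
  case (Suc m)
  from disc_convergent_linear_weight[OF this, of lam] show ?case
    by (simp add: mult.assoc)
qed (use assms in simp)

lemma disc_convergent_derived:
  assumes "disc_convergent c"
  shows "disc_convergent (\<lambda>n. real (n + 1) * c n)"
  using disc_convergent_weighted[OF assms, of 1 1] by (simp add: algebra_simps)

lemma disc_convergent_norm_summable:
  fixes z :: complex
  assumes "disc_convergent c" "norm z < 1"
  shows "summable (\<lambda>n. norm (of_real (c n) * z ^ n))"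
    and "summable (\<lambda>n. norm (of_real (c n) * z ^ (n + 1)))"
proof -
  show *: "summable (\<lambda>n. norm (of_real (c n) * z ^ n))"
    using disc_convergentD[OF assms(1), of "norm z"] assms(2)
    by (simp add: norm_mult norm_power)
  from summable_mult[OF this, of "norm z"]
  show "summable (\<lambda>n. norm (of_real (c n) * z ^ (n + 1)))"
    by (simp add: norm_mult norm_power mult_ac)
qed

lemmas disc_convergent_summable =
  disc_convergent_norm_summable[THEN summable_norm_cancel]

lemma disc_convergent_real_summable:
  assumes "disc_convergent c" "0 \<le> r" "r < 1"
  shows "summable (\<lambda>n. c n * r ^ n)"
  by (rule summable_norm_cancel) (use disc_convergentD[OF assms] assms in \<open>simp add: abs_mult\<close>)

text \<open>
  For non-negative coefficients the points of the positive real axis alone witness absolute convergence.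
\<close>

lemma disc_convergentI_complex:
  assumes "\<And>z :: complex. norm z < 1 \<Longrightarrow> summable (\<lambda>n. of_real (c n) * z ^ (n + 1))"
    and "\<And>n. c n \<ge> 0"
  shows "disc_convergent c"
  unfolding disc_convergent_def
proof (intro allI impI)
  fix r :: real assume r: "0 \<le> r \<and> r < 1"
  show "summable (\<lambda>n. \<bar>c n\<bar> * r ^ n)"
  proof (cases "r = 0")
    case True
    thus ?thesis by (intro summable_finite[of "{0}"]) auto
  next
    case False
    have "summable (\<lambda>n. Re (of_real (c n) * of_real r ^ (n + 1)))"
      using r by (intro summable_Re assms(1)) auto
    from summable_mult[OF this, of "1 / r"] show ?thesis
      using assms(2) False by (simp flip: of_real_power add: field_simps)
  qed
qed

lemma shifted_series_sums:
  assumes "disc_convergent c" "norm z < 1"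
  shows "(\<lambda>n. of_real (c n) * z ^ (n + 1)) sums shifted_series c z"
  unfolding shifted_series_def using disc_convergent_summable(2)[OF assms] by (rule summable_sums)

lemma shifted_series_of_real:
  assumes "disc_convergent c" "0 \<le> r" "r < 1"
  shows "shifted_series c (of_real r) = of_real (r * (\<Sum>n. c n * r ^ n))"
proof -
  have "(\<lambda>n. c n * r ^ n) sums (\<Sum>n. c n * r ^ n)"
    using assms by (intro summable_sums disc_convergent_real_summable)
  from sums_of_real[OF sums_mult[OF this, of r], where ?'a = complex]
  have "(\<lambda>n. complex_of_real (c n) * of_real r ^ (n + 1)) sums of_real (r * (\<Sum>n. c n * r ^ n))"
    by (simp add: mult_ac)
  moreover have "(\<lambda>n. complex_of_real (c n) * of_real r ^ (n + 1)) sums shifted_series c (of_real r)"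
    using assms by (intro shifted_series_sums) auto
  ultimately show ?thesis by (metis sums_unique2)
qed

lemma shifted_series_has_field_derivative:
  assumes "disc_convergent c" "norm z < 1"
  shows "(shifted_series c has_field_derivative (\<Sum>n. of_real (real (n + 1) * c n) * z ^ n)) (at z)"
proof -
  define d where "d = (\<lambda>n. case n of 0 \<Rightarrow> 0 | Suc m \<Rightarrow> complex_of_real (c m))"
  have d: "d 0 = 0" "\<And>n. d (Suc n) = of_real (c n)"
    by (simp_all add: d_def)
  have sums: "(\<lambda>n. d n * w ^ n) sums shifted_series c w" if "norm w < 1" for w
    using shifted_series_sums[OF assms(1) that]
      sums_Suc_iff[of "\<lambda>n. d n * w ^ n" "shifted_series c w"]
    by (simp add: d)
  have "((\<lambda>w. \<Sum>n. d n * w ^ n) has_field_derivative (\<Sum>n. diffs d n * z ^ n)) (at z)"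
    by (rule termdiffs_strong'[where K = 1]) (use sums assms in \<open>auto simp: sums_iff\<close>)
  also have "(\<Sum>n. diffs d n * z ^ n) = (\<Sum>n. of_real (real (n + 1) * c n) * z ^ n)"
    by (simp add: diffs_def d)
  finally show ?thesis
    by (rule has_field_derivative_transform_within_open[where S = "ball 0 1"])
       (use assms sums in \<open>auto simp: sums_iff\<close>)
qed

lemma shifted_series_holomorphic:
  "disc_convergent c \<Longrightarrow> shifted_series c holomorphic_on ball 0 1"
  unfolding holomorphic_on_open[OF open_ball]
  by (metis shifted_series_has_field_derivative mem_ball_0)

text \<open>
  Taylor coefficients are derivatives at 0, so they only see the values of \<open>h\<close> on the disc and are
  the coefficients of any power series that represents \<open>h\<close> there.
\<close>

lemma taylor_coeff_shifted_series:
  assumes "disc_convergent c" and eq: "\<And>z. z \<in> ball 0 1 \<Longrightarrow> h z = shifted_series c z"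
  shows "taylor_coeff h (n + 1) = of_real (c n)"
proof -
  define F where "F = Abs_fps (\<lambda>n. case n of 0 \<Rightarrow> 0 | Suc m \<Rightarrow> complex_of_real (c m))"
  have "(\<lambda>n. fps_nth F n * w ^ n) sums h w" if "w \<in> ball 0 1" for w
    using shifted_series_sums[OF assms(1), of w] that eq[OF that]
      sums_Suc_iff[of "\<lambda>n. fps_nth F n * w ^ n" "shifted_series c w"]
    by (simp add: F_def)
  hence "h has_fps_expansion F"
    by (intro has_fps_expansionI eventually_mono[OF eventually_nhds_in_open[of "ball 0 1" 0]]) auto
  hence "fps_nth F (n + 1) = (deriv ^^ (n + 1)) h 0 / fact (n + 1)"
    by (rule fps_nth_fps_expansion)
  thus ?thesis by (simp add: taylor_coeff_def F_def)
qed

lemma al_oboudi_shifted_series: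
  assumes "disc_convergent c" and "\<And>z. z \<in> ball 0 1 \<Longrightarrow> h z = shifted_series c z"
  shows "al_oboudi lam m h = shifted_series (\<lambda>n. (1 + real n * lam) ^ m * c n)"
  by (rule ext) (simp add: al_oboudi_def shifted_series_def taylor_coeff_shifted_series[OF assms, simplified])

section \<open>Wirtinger derivatives and uniqueness of the decomposition\<close>

text \<open>
  The differential of \<open>h + cnj g\<close> is the sum of a complex linear part, given by $h'$, and a conjugate
  linear part, given by $g'$; the Wirtinger derivatives are the projections onto these parts.
\<close>

lemma wirtinger_harmonic_decomp:
  assumes "harmonic_decomp f h g" "z \<in> ball 0 1"
  shows "wirtinger_z f z = deriv h z" "wirtinger_zbar f z = cnj (deriv g z)"
proof -
  have h: "(h has_field_derivative deriv h z) (at z)" and g: "(g has_field_derivative deriv g z) (at z)"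
    using assms by (auto simp: harmonic_decomp_def intro!: holomorphic_derivI[of _ "ball 0 1"])
  have "((\<lambda>z. h z + cnj (g z)) has_derivative (\<lambda>x. deriv h z * x + cnj (deriv g z * x))) (at z)"
    using h g unfolding has_field_derivative_def by (intro has_derivative_add has_derivative_cnj)
  hence "(f has_derivative (\<lambda>x. deriv h z * x + cnj (deriv g z * x))) (at z)"
    by (rule has_derivative_transform_within_open[where s = "ball 0 1"])
       (use assms in \<open>auto simp: harmonic_decomp_def\<close>)
  hence eq: "frechet_derivative f (at z) = (\<lambda>x. deriv h z * x + cnj (deriv g z * x))"
    using frechet_derivative_at by metis
  show "wirtinger_z f z = deriv h z" "wirtinger_zbar f z = cnj (deriv g z)"
    unfolding wirtinger_z_def wirtinger_zbar_def eq by (auto simp: algebra_simps)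
qed

text \<open>
  The Wirtinger derivatives of \<open>f\<close> determine $g'$, and \<open>g 0 = 0\<close> fixes the constant.  This is what
  allows the decomposition in \<^const>\<open>k_USH\<close> to be identified with the one in \<^const>\<open>k_UTH\<close>.
\<close>

lemma harmonic_decomp_unique:
  assumes "harmonic_decomp f h g" "harmonic_decomp f h' g'" "z \<in> ball 0 1"
  shows "h z = h' z" "g z = g' z"
proof -
  note hol = assms(1,2)[unfolded harmonic_decomp_def]
  have "deriv g w = deriv g' w" if "w \<in> ball 0 1" for w
    using wirtinger_harmonic_decomp(2)[OF assms(1) that] wirtinger_harmonic_decomp(2)[OF assms(2) that]
    by simp
  moreover have "(g has_field_derivative deriv g w) (at w within ball 0 1)"
    and "(g' has_field_derivative deriv g' w) (at w within ball 0 1)" if "w \<in> ball 0 1" for w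
    using hol that by (simp_all add: holomorphic_derivI[of _ "ball 0 1"] has_field_derivative_at_within)
  ultimately have "((\<lambda>w. g w - g' w) has_field_derivative 0) (at w within ball 0 1)"
    if "w \<in> ball 0 1" for w
    using DERIV_diff that by fastforce
  then obtain C where C: "\<And>w. w \<in> ball 0 1 \<Longrightarrow> g w - g' w = C"
    using has_field_derivative_zero_constant[of "ball 0 1" "\<lambda>w. g w - g' w"] by auto
  from C[of 0] hol have "C = 0" by auto
  with C[OF assms(3)] show "g z = g' z" by simp
  moreover have "h z + cnj (g z) = h' z + cnj (g' z)" using hol assms(3) by metis
  ultimately show "h z = h' z" by simp
qed

lemma shifted_series_0 [simp]: "shifted_series c 0 = 0"
  by (simp add: shifted_series_def)

lemma shifted_series_cmult:
  assumes "disc_convergent c" "norm z < 1"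
  shows "shifted_series (\<lambda>n. x * c n) z = of_real x * shifted_series c z"
  using sums_mult[OF shifted_series_sums[OF assms], of "of_real x"]
  by (simp add: shifted_series_def sums_iff mult.assoc)

lemma shifted_series_add:
  assumes "disc_convergent c" "disc_convergent d" "norm z < 1"
  shows "shifted_series (\<lambda>n. c n + d n) z = shifted_series c z + shifted_series d z"
  using sums_add[OF shifted_series_sums[OF assms(1,3)] shifted_series_sums[OF assms(2,3)]]
  by (simp add: shifted_series_def sums_iff algebra_simps)

lemma disc_convergent_delta: "disc_convergent (\<lambda>n. of_bool (n = 0))"
  by (rule disc_convergent_bounded) auto

lemma shifted_series_delta: "shifted_series (\<lambda>n. of_bool (n = 0)) z = z"
  using suminf_finite[of "{0}" "\<lambda>n. complex_of_real (of_bool (n = 0)) * z ^ (n + 1)"]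
  by (simp add: shifted_series_def)

lemma shifted_series_delta_diff:
  assumes "disc_convergent c" "norm z < 1"
  shows "shifted_series (\<lambda>n. of_bool (n = 0) - c n) z = z - shifted_series c z"
  using shifted_series_add[OF disc_convergent_delta disc_convergent_cmult[OF assms(1), of "-1"] assms(2)]
    shifted_series_cmult[OF assms, of "-1"]
  by (simp add: shifted_series_delta)

section \<open>Estimates for power series\<close>

lemma norm_power_series_le:
  assumes "disc_convergent c" "norm (z :: complex) \<le> r" "r < 1"
  shows "norm (\<Sum>n. of_real (c n) * z ^ n) \<le> (\<Sum>n. \<bar>c n\<bar> * r ^ n)"
proof -
  have r: "0 \<le> r" using assms(2) norm_ge_zero order_trans by blast
  show ?thesis
  proof (rule norm_suminf_le)
    show "norm (of_real (c n) * z ^ n) \<le> \<bar>c n\<bar> * r ^ n" for n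
      using assms(2) by (simp add: norm_mult norm_power mult_left_mono power_mono)
  qed (use assms r in \<open>simp add: disc_convergentD\<close>)
qed

text \<open>
  The derivative of $z^{n+1}$ is bounded by $(n+1) r^n$ on the disc of radius \<open>r\<close>.
\<close>

lemma norm_power_diff_le:
  fixes z w :: "'a :: real_normed_field"
  assumes "norm z \<le> r" "norm w \<le> r"
  shows "norm (z ^ (n + 1) - w ^ (n + 1)) \<le> (real n + 1) * r ^ n * norm (z - w)"
proof (induction n)
  case (Suc n)
  have r: "0 \<le> r" using assms(1) norm_ge_zero order_trans by blast
  have "z ^ (Suc n + 1) - w ^ (Suc n + 1) = z * (z ^ (n + 1) - w ^ (n + 1)) + (z - w) * w ^ (n + 1)"
    by (simp add: algebra_simps)
  also have "norm \<dots> \<le> norm z * norm (z ^ (n + 1) - w ^ (n + 1)) + norm (z - w) * norm w ^ (n + 1)"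
    by (metis norm_mult norm_power norm_triangle_ineq)
  also have "\<dots> \<le> r * ((real n + 1) * r ^ n * norm (z - w)) + norm (z - w) * r ^ (n + 1)"
    using assms r Suc.IH by (intro add_mono mult_mono power_mono order_refl) auto
  also have "\<dots> = (real (Suc n) + 1) * r ^ Suc n * norm (z - w)"
    by (simp add: algebra_simps)
  finally show ?case .
qed simp

lemma shifted_series_lipschitz:
  assumes "disc_convergent c" "norm z \<le> r" "norm w \<le> r" "r < 1"
  shows "norm (shifted_series c z - shifted_series c w)
           \<le> (\<Sum>n. \<bar>real (n + 1) * c n\<bar> * r ^ n) * norm (z - w)"
proof -
  have r: "0 \<le> r" using assms(2) norm_ge_zero order_trans by blast
  have sums: "(\<lambda>n. of_real (c n) * z ^ (n + 1) - of_real (c n) * w ^ (n + 1)) sums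
               (shifted_series c z - shifted_series c w)"
    using assms by (intro sums_diff shifted_series_sums) auto
  have summ: "summable (\<lambda>n. \<bar>real (n + 1) * c n\<bar> * r ^ n)"
    using assms r by (intro disc_convergentD disc_convergent_derived)
  have "norm (\<Sum>n. of_real (c n) * z ^ (n + 1) - of_real (c n) * w ^ (n + 1))
          \<le> (\<Sum>n. \<bar>real (n + 1) * c n\<bar> * r ^ n * norm (z - w))"
  proof (rule norm_suminf_le)
    fix n
    have "norm (of_real (c n) * z ^ (n + 1) - of_real (c n) * w ^ (n + 1)) =
            \<bar>c n\<bar> * norm (z ^ (n + 1) - w ^ (n + 1))"
      by (simp flip: right_diff_distrib add: norm_mult)
    also have "\<dots> \<le> \<bar>c n\<bar> * ((real n + 1) * r ^ n * norm (z - w))"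
      using assms by (intro mult_left_mono norm_power_diff_le) auto
    also have "\<dots> = \<bar>real (n + 1) * c n\<bar> * r ^ n * norm (z - w)"
      by (simp add: abs_mult)
    finally show "norm (of_real (c n) * z ^ (n + 1) - of_real (c n) * w ^ (n + 1))
                    \<le> \<bar>real (n + 1) * c n\<bar> * r ^ n * norm (z - w)" .
  qed (use summ in \<open>rule summable_mult2\<close>)
  thus ?thesis
    using sums suminf_mult2[OF summ, of "norm (z - w)"] by (simp add: sums_iff)
qed

text \<open>
  A finite partial sum is continuous up to \<open>r = 1\<close>, and for non-negative coefficients it is bounded by
  the whole series; so the bound passes to the limit although the series itself might diverge at 1.
\<close>

lemma partial_sums_le_of_power_series_le:
  fixes d :: "nat \<Rightarrow> real"
  assumes "disc_convergent d" "\<And>n. d n \<ge> 0"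
    and le: "\<And>r. 0 < r \<Longrightarrow> r < 1 \<Longrightarrow> (\<Sum>n. d n * r ^ n) \<le> C"
  shows "(\<Sum>n<N. d n) \<le> C"
proof (rule tendsto_upperbound)
  have "((\<lambda>r. \<Sum>n<N. d n * r ^ n) \<longlongrightarrow> (\<Sum>n<N. d n * 1 ^ n)) (at_left 1)"
    by (intro tendsto_intros)
  thus "((\<lambda>r. \<Sum>n<N. d n * r ^ n) \<longlongrightarrow> (\<Sum>n<N. d n)) (at_left 1)"
    by simp
  have "(\<Sum>n<N. d n * r ^ n) \<le> C" if "r \<in> {0<..<1}" for r
  proof -
    have "(\<Sum>n<N. d n * r ^ n) \<le> (\<Sum>n. d n * r ^ n)"
      using that assms by (intro sum_le_suminf disc_convergent_real_summable) auto
    also have "\<dots> \<le> C" using that by (intro le) auto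
    finally show ?thesis .
  qed
  thus "\<forall>\<^sub>F r in at_left 1. (\<Sum>n<N. d n * r ^ n) \<le> C"
    by (intro eventually_mono[OF eventually_at_left_real[of 0 1]]) auto
qed auto

text \<open>
  On the interval from 0 to 1 the function is continuous, starts below 1 and omits the value 1.
  The lemma turns a non-vanishing condition for complex functions, restricted to the real axis,
  into the sign that is needed to remove absolute values and to multiply out quotients.
\<close>

lemma power_series_less_one:
  fixes d :: "nat \<Rightarrow> real"
  assumes "disc_convergent d" "d 0 < 1" "0 \<le> r" "r < 1"
    and ne: "\<And>s. 0 < s \<Longrightarrow> s < 1 \<Longrightarrow> (\<Sum>n. d n * s ^ n) \<noteq> 1"
  shows "(\<Sum>n. d n * r ^ n) < 1"
proof (rule ccontr)
  assume "\<not> (\<Sum>n. d n * r ^ n) < 1"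
  have summ: "summable (\<lambda>n. d n * x ^ n)" if "norm x < 1" for x
    by (rule summable_norm_cancel)
       (use disc_convergentD[OF assms(1), of "\<bar>x\<bar>"] that in \<open>simp add: abs_mult power_abs\<close>)
  have at_0: "(\<Sum>n. d n * 0 ^ n) = d 0"
    by (rule powser_zero)
  have "\<exists>x\<ge>0. x \<le> r \<and> (\<Sum>n. d n * x ^ n) = 1"
  proof (rule IVT)
    show "\<forall>x. 0 \<le> x \<and> x \<le> r \<longrightarrow> isCont (\<lambda>x. \<Sum>n. d n * x ^ n) x"
      using assms(4) by (auto intro!: DERIV_isCont[OF termdiffs_strong'[where K = 1]] summ)
  qed (use assms at_0 \<open>\<not> _\<close> in auto)
  then obtain x where x: "0 \<le> x" "x \<le> r" "(\<Sum>n. d n * x ^ n) = 1" by blast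
  hence "x \<noteq> 0" using at_0 assms(2) by auto
  with x ne[of x] assms(4) show False by auto
qed

text \<open>
  Moving all of the mass except the term with index 0 to the first power of \<open>r\<close> gives the
  bound $(1-r) d_0 + r \sum_n d_n$, a convex combination of a number below 1, with positive weight, and a number
  that is at most 1.
\<close>

lemma power_series_less_one_of_partial_sums:
  fixes d :: "nat \<Rightarrow> real"
  assumes "\<And>n. d n \<ge> 0" "\<And>N. (\<Sum>n<N. d n) \<le> 1" "d 0 < 1" "0 \<le> r" "r < 1"
  shows "summable (\<lambda>n. d n * r ^ n)" "(\<Sum>n. d n * r ^ n) < 1"
proof -
  have summ: "summable d"
    using assms(1,2) by (intro summableI_nonneg_bounded)
  have total: "suminf d \<le> 1"
    using assms(2) summ by (intro suminf_le_const)
  \<comment> \<open>Termwise majorant whose sum is the convex combination of d 0 and the sum of d.\<close>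
  define e where "e = (\<lambda>n. (if n = 0 then (1 - r) * d 0 else 0) + r * d n)"
  have e: "e sums ((1 - r) * d 0 + r * suminf d)"
    unfolding e_def
    using sums_single[of 0 "\<lambda>_. (1 - r) * d 0"] summ
    by (intro sums_add sums_mult summable_sums)
  have le: "d n * r ^ n \<le> e n" for n
  proof (cases n)
    case (Suc m)
    have "d n * (r * r ^ m) \<le> d n * (r * 1)"
      using assms by (intro mult_left_mono power_le_one) auto
    thus ?thesis by (simp add: Suc e_def mult.commute)
  qed (simp add: e_def algebra_simps)
  show summ': "summable (\<lambda>n. d n * r ^ n)"
    by (rule summable_comparison_test'[of e 0]) (use e le assms in \<open>auto simp: sums_iff\<close>)
  have "(\<Sum>n. d n * r ^ n) \<le> (1 - r) * d 0 + r * suminf d"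
    using suminf_le[OF le summ'] e by (simp add: sums_iff)
  also have "\<dots> < (1 - r) * 1 + r * 1"
    using assms total by (intro add_less_le_mono mult_strict_left_mono mult_left_mono) auto
  finally show "(\<Sum>n. d n * r ^ n) < 1" by simp
qed

section \<open>Univalent sense-preserving functions with negative coefficients\<close>

text \<open>
  The function of the prescribed form with coefficient moduli \<open>p\<close> and \<open>q\<close>, that is $p_n = |a_{n+1}|$ and
  $q_n = |b_{n+1}|$.  The leading term \<open>z\<close> is kept apart, so \<open>p\<close> is used with \<open>p 0 = 0\<close>.
\<close>

definition neg_harmonic :: "nat \<Rightarrow> (nat \<Rightarrow> real) \<Rightarrow> (nat \<Rightarrow> real) \<Rightarrow> complex \<Rightarrow> complex" where
  "neg_harmonic u p q z = z - shifted_series p z + (- 1) ^ (u - 1) * cnj (shifted_series q z)"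

lemma neg_harmonic_decomp:
  assumes "disc_convergent p" "disc_convergent q"
    and "\<And>z. z \<in> ball 0 1 \<Longrightarrow> f z = neg_harmonic u p q z"
  shows "harmonic_decomp f (\<lambda>z. z - shifted_series p z) (\<lambda>z. (- 1) ^ (u - 1) * shifted_series q z)"
  unfolding harmonic_decomp_def
  using assms shifted_series_holomorphic[OF assms(1)] shifted_series_holomorphic[OF assms(2)]
  by (auto simp: neg_harmonic_def intro!: holomorphic_intros)

lemma deriv_neg_harmonic_parts:
  assumes "disc_convergent c" "norm z < 1"
  shows "deriv (\<lambda>z. z - shifted_series c z) z = 1 - (\<Sum>n. of_real (real (n + 1) * c n) * z ^ n)"
    and "deriv (\<lambda>z. x * shifted_series c z) z = x * (\<Sum>n. of_real (real (n + 1) * c n) * z ^ n)"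
  using shifted_series_has_field_derivative[OF assms]
  by (auto intro!: DERIV_imp_deriv derivative_eq_intros)

lemma power_series_of_real:
  assumes "disc_convergent c" "0 \<le> r" "r < 1"
  shows "(\<Sum>n. of_real (c n) * of_real r ^ n) = complex_of_real (\<Sum>n. c n * r ^ n)"
  using suminf_of_real[OF disc_convergent_real_summable[OF assms], where ?'a = complex] by simp

text \<open>
  The coefficient bound makes \<open>z\<close> dominate the rest of the function on every disc of radius
  \<open>r < 1\<close>: the remaining terms have Lipschitz constant $\sum_n (n+1)(p_n+q_n) r^n < 1$.  This gives
  injectivity, and the same estimate for the derivatives gives $|g'| < |h'|$.
\<close>

lemma neg_harmonic_in_SH:
  assumes nonneg: "\<And>n. p n \<ge> 0" "\<And>n. q n \<ge> 0" and "p 0 = 0" "q 0 < 1"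
    and bound: "\<And>N. (\<Sum>n<N. real (n + 1) * (p n + q n)) \<le> 1"
    and conv: "disc_convergent p" "disc_convergent q"
    and f: "\<And>z. z \<in> ball 0 1 \<Longrightarrow> f z = neg_harmonic u p q z"
  shows "f \<in> SH"
proof -
  define h where "h = (\<lambda>z. z - shifted_series p z)"
  define g where "g = (\<lambda>z. (- 1) ^ (u - 1) * shifted_series q z)"
  have decomp: "harmonic_decomp f h g"
    unfolding h_def g_def using conv f by (rule neg_harmonic_decomp)
  have "taylor_coeff g (0 + 1) = of_real ((- 1) ^ (u - 1) * q 0)"
    by (rule taylor_coeff_shifted_series[where c = "\<lambda>n. (- 1) ^ (u - 1) * q n"])
       (auto simp: g_def conv shifted_series_cmult intro!: disc_convergent_cmult)
  hence coeff: "cmod (taylor_coeff g 1) < 1"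
    using nonneg(2)[of 0] \<open>q 0 < 1\<close> by (simp add: norm_mult norm_power)
  define P where "P = (\<lambda>r. \<Sum>n. \<bar>real (n + 1) * p n\<bar> * r ^ n)"
  define Q where "Q = (\<lambda>r. \<Sum>n. \<bar>real (n + 1) * q n\<bar> * r ^ n)"
  have PQ: "P r + Q r < 1" if "0 \<le> r" "r < 1" for r
  proof -
    have "P r + Q r = (\<Sum>n. \<bar>real (n + 1) * p n\<bar> * r ^ n + \<bar>real (n + 1) * q n\<bar> * r ^ n)"
      unfolding P_def Q_def using that conv
      by (intro suminf_add disc_convergentD disc_convergent_derived)
    also have "\<dots> = (\<Sum>n. (real (n + 1) * (p n + q n)) * r ^ n)"
      using nonneg by (simp add: abs_mult algebra_simps)
    also have "\<dots> < 1"
      using nonneg bound that \<open>p 0 = 0\<close> \<open>q 0 < 1\<close>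
      by (intro power_series_less_one_of_partial_sums) auto
    finally show ?thesis .
  qed
  have "inj_on f (ball 0 1)"
  proof (rule inj_onI, rule ccontr)
    fix z w assume zw: "z \<in> ball 0 1" "w \<in> ball 0 1" "f z = f w" "z \<noteq> w"
    define r where "r = max (norm z) (norm w)"
    have r: "0 \<le> r" "r < 1" "norm z \<le> r" "norm w \<le> r"
      using zw by (auto simp: r_def le_max_iff_disj)
    \<comment> \<open>If f takes the same value at z and w, then z - w is the increment of the
      remaining terms, which is too small.\<close>
    have "z - w = (shifted_series p z - shifted_series p w)
                  - (- 1) ^ (u - 1) * cnj (shifted_series q z - shifted_series q w)"
      using zw f by (simp add: neg_harmonic_def algebra_simps)
    hence "norm (z - w) \<le> norm (shifted_series p z - shifted_series p w)
        + norm ((- 1) ^ (u - 1) * cnj (shifted_series q z - shifted_series q w))"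
      by (metis norm_triangle_ineq4)
    also have "norm ((- 1) ^ (u - 1) * cnj (shifted_series q z - shifted_series q w))
                 = norm (shifted_series q z - shifted_series q w)"
      by (simp only: norm_mult norm_power norm_minus_cancel norm_one complex_mod_cnj power_one mult_1)
    also have "norm (shifted_series p z - shifted_series p w) + norm (shifted_series q z - shifted_series q w)
                 \<le> P r * norm (z - w) + Q r * norm (z - w)"
      unfolding P_def Q_def using conv r by (intro add_mono shifted_series_lipschitz)
    also have "\<dots> = (P r + Q r) * norm (z - w)"
      by (simp add: algebra_simps)
    also have "\<dots> < 1 * norm (z - w)"
      using PQ[OF r(1,2)] zw by (intro mult_strict_right_mono) auto
    finally show False by simp
  qed
  moreover have "sense_preserving_on f (ball 0 1)"
    unfolding sense_preserving_on_def
  proof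
    fix z :: complex assume z: "z \<in> ball 0 1"
    have "norm (1 - deriv h z) \<le> P (norm z)" "norm (deriv g z) \<le> Q (norm z)"
      using z conv norm_power_series_le[OF disc_convergent_derived, of p z "norm z"]
        norm_power_series_le[OF disc_convergent_derived, of q z "norm z"]
      by (simp_all add: h_def g_def P_def Q_def deriv_neg_harmonic_parts norm_mult norm_power)
    moreover have "1 \<le> norm (1 - deriv h z) + norm (deriv h z)"
      using norm_triangle_ineq[of "1 - deriv h z" "deriv h z"] by simp
    ultimately have "norm (deriv g z) < norm (deriv h z)"
      using PQ[of "norm z"] z by simp
    hence "(norm (deriv g z))\<^sup>2 < (norm (deriv h z))\<^sup>2"
      by (intro power_strict_mono) auto
    thus "0 < (cmod (wirtinger_z f z))\<^sup>2 - (cmod (wirtinger_zbar f z))\<^sup>2"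
      by (simp add: wirtinger_harmonic_decomp[OF decomp z])
  qed
  moreover have "f 0 = 0"
    using f[of 0] by (simp add: neg_harmonic_def)
  moreover have "wirtinger_z f 0 = 1"
    using wirtinger_harmonic_decomp(1)[OF decomp, of 0] conv \<open>p 0 = 0\<close>
      powser_zero[of "\<lambda>n. complex_of_real (real (n + 1) * p n)"]
    by (simp add: h_def deriv_neg_harmonic_parts)
  ultimately show ?thesis
    using decomp coeff by (auto simp: SH_def)
qed

text \<open>
  On the positive real axis $h' = 1 - \sum_n (n+1) p_n r^n$ and $|g'| = \sum_n (n+1) q_n r^n$, without
  cancellation.  The Jacobian condition forbids $h' = 0$, hence $h' > 0$ by continuity, and
  $|g'| < |h'|$ becomes the coefficient bound as \<open>r\<close> tends to 1.
\<close>

lemma SH_neg_harmonic_partial_sums: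
  assumes nonneg: "\<And>n. p n \<ge> 0" "\<And>n. q n \<ge> 0" and "p 0 = 0"
    and conv: "disc_convergent p" "disc_convergent q"
    and f: "\<And>z. z \<in> ball 0 1 \<Longrightarrow> f z = neg_harmonic u p q z"
    and SH: "f \<in> SH"
  shows "(\<Sum>n<N. real (n + 1) * (p n + q n)) \<le> 1"
proof -
  have decomp: "harmonic_decomp f (\<lambda>z. z - shifted_series p z) (\<lambda>z. (- 1) ^ (u - 1) * shifted_series q z)"
    using conv f by (rule neg_harmonic_decomp)
  note conv' = disc_convergent_derived[OF conv(1)] disc_convergent_derived[OF conv(2)]
  define P where "P = (\<lambda>r. \<Sum>n. real (n + 1) * p n * r ^ n)"
  define Q where "Q = (\<lambda>r. \<Sum>n. real (n + 1) * q n * r ^ n)"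
  have sense: "(Q r)\<^sup>2 < (1 - P r)\<^sup>2" if "0 \<le> r" "r < 1" for r
  proof -
    have r: "complex_of_real r \<in> ball 0 1" using that by simp
    have "wirtinger_z f r = of_real (1 - P r)" "wirtinger_zbar f r = of_real ((- 1) ^ (u - 1) * Q r)"
      using that power_series_of_real[OF conv'(1) that] power_series_of_real[OF conv'(2) that]
      unfolding wirtinger_harmonic_decomp[OF decomp r] P_def Q_def
      by (simp_all add: deriv_neg_harmonic_parts conv)
    moreover have "(norm (wirtinger_zbar f r))\<^sup>2 < (norm (wirtinger_z f r))\<^sup>2"
      using SH r by (auto simp: SH_def sense_preserving_on_def)
    ultimately have "\<bar>(- 1) ^ (u - 1) * Q r\<bar>\<^sup>2 < \<bar>1 - P r\<bar>\<^sup>2"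
      by (simp only: norm_of_real)
    thus ?thesis by (simp add: abs_mult power_abs)
  qed
  have P: "P r < 1" if "0 \<le> r" "r < 1" for r
    unfolding P_def
  proof (rule power_series_less_one[OF conv'(1)])
    fix s :: real assume "0 < s" "s < 1"
    with sense[of s] show "(\<Sum>n. real (n + 1) * p n * s ^ n) \<noteq> 1"
      by (auto simp: P_def)
  qed (use that \<open>p 0 = 0\<close> in auto)
  have "(\<Sum>n. real (n + 1) * (p n + q n) * r ^ n) \<le> 1" if r: "0 < r" "r < 1" for r
  proof -
    have "P r + Q r = (\<Sum>n. real (n + 1) * p n * r ^ n + real (n + 1) * q n * r ^ n)"
      unfolding P_def Q_def using r conv'
      by (intro suminf_add disc_convergent_real_summable) auto
    hence "(\<Sum>n. real (n + 1) * (p n + q n) * r ^ n) = P r + Q r"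
      by (simp add: algebra_simps)
    moreover have "Q r < 1 - P r"
      using r P[of r] by (intro power2_less_imp_less[OF sense]) auto
    ultimately show ?thesis by simp
  qed
  moreover have "disc_convergent (\<lambda>n. real (n + 1) * (p n + q n))"
    using conv by (intro disc_convergent_derived disc_convergent_add)
  ultimately show ?thesis
    using nonneg by (intro partial_sums_le_of_power_series_le) auto
qed

section \<open>The ratio condition as a coefficient inequality\<close>

text \<open>
  Two series are estimated at the same time because in the application only the sum of the two
  norms of the terms has a convenient bound.
\<close>

lemma norm_sums_add_le:
  fixes a b :: "nat \<Rightarrow> 'a :: banach"
  assumes "a sums S" "b sums T" "\<And>n. norm (a n) + norm (b n) \<le> c n" "c sums C"
  shows "norm S + norm T \<le> C"
proof -
  have le: "norm (a n) \<le> c n" "norm (b n) \<le> c n" for n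
    using assms(3)[of n] norm_ge_zero[of "a n"] norm_ge_zero[of "b n"] by linarith+
  have summ: "summable (\<lambda>n. norm (a n))" "summable (\<lambda>n. norm (b n))"
    using assms(4) le by (auto intro!: summable_comparison_test'[of c 0] simp: sums_iff)
  have "norm S + norm T \<le> (\<Sum>n. norm (a n)) + (\<Sum>n. norm (b n))"
    using assms(1,2) summable_norm[OF summ(1)] summable_norm[OF summ(2)] by (auto simp: sums_iff)
  also have "\<dots> = (\<Sum>n. norm (a n) + norm (b n))"
    using summ by (rule suminf_add)
  also have "\<dots> \<le> C"
    using suminf_le[OF assms(3) summable_add[OF summ]] assms(4) by (simp add: sums_iff)
  finally show ?thesis .
qed

lemma norm_shifted_series_le:
  assumes "disc_convergent c" "norm z < 1"
  shows "norm (shifted_series c z) \<le> norm z * (\<Sum>n. \<bar>c n\<bar> * norm z ^ n)"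
proof -
  have "shifted_series c z = z * (\<Sum>n. of_real (c n) * z ^ n)"
    using suminf_mult[OF disc_convergent_summable(1)[OF assms], of z]
    by (simp add: shifted_series_def mult_ac)
  thus ?thesis
    using assms by (simp add: norm_mult mult_left_mono norm_power_series_le)
qed

text \<open>
  The half plane consists of the points that are at least as close to $2\alpha - 1$ as to 1, because \<open>\<alpha>\<close>
  is the midpoint of these two real numbers.
\<close>

lemma Re_ge_iff_norm_le:
  assumes "\<alpha> < 1"
  shows "Re w \<ge> \<alpha> \<longleftrightarrow> norm (w - 1) \<le> norm (w + of_real (1 - 2 * \<alpha>))"
proof -
  have "norm (w - 1) \<le> norm (w + of_real (1 - 2 * \<alpha>)) \<longleftrightarrow>
        (norm (w - 1))\<^sup>2 \<le> (norm (w + of_real (1 - 2 * \<alpha>)))\<^sup>2"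
    by (simp add: abs_le_square_iff)
  also have "\<dots> \<longleftrightarrow> 0 \<le> 4 * ((1 - \<alpha>) * (Re w - \<alpha>))"
    unfolding cmod_power2 by (simp add: power2_eq_square algebra_simps)
  also have "\<dots> \<longleftrightarrow> Re w \<ge> \<alpha>"
    using assms by (simp add: zero_le_mult_iff)
  finally show ?thesis ..
qed

text \<open>
  The weight with which a coefficient modulus enters the inequality for the ratio.  The sign \<open>s\<close> is 1
  for the analytic part and $(-1)^{u+v}$ for the co-analytic part, where $D^u$ and $D^v$ carry the
  signs $(-1)^u$ and $(-1)^v$.
\<close>

definition ratio_weight :: "real \<Rightarrow> nat \<Rightarrow> nat \<Rightarrow> real \<Rightarrow> real \<Rightarrow> real \<Rightarrow> nat \<Rightarrow> real" where
  "ratio_weight k u v \<alpha> lam s n =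
     (1 + k) * (1 + real n * lam) ^ u - s * (k + \<alpha>) * (1 + real n * lam) ^ v"

text \<open>
  The two coefficients are those of $X$ and $Y$ in \<open>ratio_condition_of_coeffs\<close> below.  The first one equals
  $(U + (1-2\alpha) s V) + \kappa (U - s V)$.  Both numbers in parentheses are non-negative for every admissible
  \<open>\<alpha>\<close> and both signs \<open>s\<close>, since \<open>V \<le> U\<close>, so that the triangle inequality only has to separate \<open>\<kappa>\<close> and the
  bounds add up to exactly twice the ratio weight.
\<close>

lemma norm_coeffs_le:
  fixes \<kappa> :: complex
  assumes "norm \<kappa> = k" "0 \<le> \<alpha>" "\<alpha> < 1" "0 < V" "V \<le> U" "\<bar>s\<bar> = 1"
  shows "norm ((1 + \<kappa>) * of_real U + (of_real (1 - 2 * \<alpha>) - \<kappa>) * of_real (s * V))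
           + norm ((1 + \<kappa>) * of_real (U - s * V))
         \<le> 2 * ((1 + k) * U - s * (k + \<alpha>) * V)"
proof -
  have sV: "\<bar>s * V\<bar> \<le> U" "\<bar>(1 - 2 * \<alpha>) * (s * V)\<bar> \<le> U"
  proof -
    show "\<bar>s * V\<bar> \<le> U" using assms by (simp add: abs_mult)
    moreover have "\<bar>1 - 2 * \<alpha>\<bar> * \<bar>s * V\<bar> \<le> 1 * \<bar>s * V\<bar>"
      using assms by (intro mult_right_mono) auto
    ultimately show "\<bar>(1 - 2 * \<alpha>) * (s * V)\<bar> \<le> U" by (simp add: abs_mult)
  qed
  have "(1 + \<kappa>) * of_real U + (of_real (1 - 2 * \<alpha>) - \<kappa>) * of_real (s * V) =
        of_real (U + (1 - 2 * \<alpha>) * (s * V)) + \<kappa> * of_real (U - s * V)"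
    by (simp add: algebra_simps)
  also have "norm \<dots> \<le> norm (complex_of_real (U + (1 - 2 * \<alpha>) * (s * V))) + norm (\<kappa> * of_real (U - s * V))"
    by (rule norm_triangle_ineq)
  also have "\<dots> = U + (1 - 2 * \<alpha>) * (s * V) + k * (U - s * V)"
    unfolding norm_mult norm_of_real assms(1) using sV by simp
  finally have 1: "norm ((1 + \<kappa>) * of_real U + (of_real (1 - 2 * \<alpha>) - \<kappa>) * of_real (s * V))
                     \<le> U + (1 - 2 * \<alpha>) * (s * V) + k * (U - s * V)" .
  have "norm ((1 + \<kappa>) * of_real (U - s * V)) = norm (1 + \<kappa>) * (U - s * V)"
    unfolding norm_mult norm_of_real using sV by simp
  also have "\<dots> \<le> (1 + k) * (U - s * V)"
    using sV norm_triangle_ineq[of 1 \<kappa>] assms(1) by (intro mult_right_mono) auto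
  finally show ?thesis using 1 by (simp add: algebra_simps)
qed

lemma power_weights:
  assumes "lam \<ge> 0" "v < u"
  shows "1 \<le> (1 + real n * lam) ^ v" "(1 + real n * lam) ^ v \<le> (1 + real n * lam) ^ u"
  using assms by (auto intro!: one_le_power power_increasing)

text \<open>
  This lower bound makes the weights positive and compares them with the coefficients of $D^v f$, which
  is how the inequality for the weights also keeps $D^v f$ away from 0.
\<close>

lemma ratio_weight_ge:
  assumes "lam \<ge> 0" "v < u" "0 \<le> \<alpha>" "\<alpha> < 1" "0 \<le> k" "\<bar>s\<bar> = 1"
  shows "(1 - \<alpha>) * (1 + real n * lam) ^ v \<le> ratio_weight k u v \<alpha> lam s n"
proof -
  note w = power_weights[OF assms(1,2), of n]
  have "s * ((k + \<alpha>) * (1 + real n * lam) ^ v) \<le> (k + \<alpha>) * (1 + real n * lam) ^ v"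
    using assms w mult_right_mono[of s 1 "(k + \<alpha>) * (1 + real n * lam) ^ v"] by auto
  moreover have "(1 + k) * (1 + real n * lam) ^ v \<le> (1 + k) * (1 + real n * lam) ^ u"
    using w assms by (intro mult_left_mono) auto
  ultimately show ?thesis
    by (simp add: ratio_weight_def algebra_simps)
qed

text \<open>
  The sign $(-1)^m$ of the operator and the sign $(-1)^{u-1}$ of the co-analytic part combine to
  $-(-1)^{u+m}$.  For \<open>m = u\<close> this is $-1$, so that in $D^u f$ both series are subtracted.
\<close>

lemma al_oboudi_harmonic_neg:
  assumes conv: "disc_convergent p" "disc_convergent q" and "u \<ge> 1" "norm z < 1"
    and h: "\<And>z. z \<in> ball 0 1 \<Longrightarrow> h z = z - shifted_series p z"
    and g: "\<And>z. z \<in> ball 0 1 \<Longrightarrow> g z = (- 1) ^ (u - 1) * shifted_series q z"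
  shows "al_oboudi_harmonic lam m h g z =
           z - shifted_series (\<lambda>n. (1 + real n * lam) ^ m * p n) z
             - (- 1) ^ (u + m) * cnj (shifted_series (\<lambda>n. (1 + real n * lam) ^ m * q n) z)"
proof -
  note conv' = conv[THEN disc_convergent_weighted[of _ lam m]]
  have "al_oboudi lam m h z =
          shifted_series (\<lambda>n. (1 + real n * lam) ^ m * (of_bool (n = 0) - p n)) z"
    by (subst al_oboudi_shifted_series[where c = "\<lambda>n. of_bool (n = 0) - p n"])
       (use conv h in \<open>auto simp: shifted_series_delta_diff intro!: disc_convergent_diff disc_convergent_delta\<close>)
  also have "(\<lambda>n. (1 + real n * lam) ^ m * (of_bool (n = 0) - p n)) =
             (\<lambda>n. of_bool (n = 0) - (1 + real n * lam) ^ m * p n)"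
    by (auto simp: of_bool_def algebra_simps)
  also have "shifted_series \<dots> z = z - shifted_series (\<lambda>n. (1 + real n * lam) ^ m * p n) z"
    using conv' assms(4) by (simp add: shifted_series_delta_diff)
  finally have 1: "al_oboudi lam m h z = \<dots>" .
  have "al_oboudi lam m g z =
          shifted_series (\<lambda>n. (1 + real n * lam) ^ m * ((- 1) ^ (u - 1) * q n)) z"
    by (subst al_oboudi_shifted_series[where c = "\<lambda>n. (- 1) ^ (u - 1) * q n"])
       (use conv g in \<open>auto simp: shifted_series_cmult intro!: disc_convergent_cmult\<close>)
  also have "\<dots> = (- 1) ^ (u - 1) * shifted_series (\<lambda>n. (1 + real n * lam) ^ m * q n) z"
    using shifted_series_cmult[OF conv'(2) assms(4), of "(- 1) ^ (u - 1)"] by (simp add: mult_ac)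
  finally have 2: "al_oboudi lam m g z = \<dots>" .
  obtain u' where "u = Suc u'" using \<open>u \<ge> 1\<close> by (cases u) auto
  thus ?thesis unfolding al_oboudi_harmonic_def 1 2 by (simp add: power_add mult_ac)
qed

text \<open>
  Write \<open>P\<close> for $D^u f(z)$, \<open>Q\<close> for $D^v f(z)$ and \<open>\<kappa>\<close> for $k e^{i\phi}$.  After multiplication by \<open>Q\<close> the
  condition that $W = (1+\kappa) P/Q - \kappa$ lies in the half plane reads $|Y| \<le> |X|$ with
  $Y = (1+\kappa)(P-Q)$ and $X = (1+\kappa)P + (1-2\alpha-\kappa)Q$.  The leading terms cancel in \<open>Y\<close> and add up to
  $2(1-\alpha)z$ in \<open>X\<close>, and the coefficient inequality says that all other terms of \<open>X\<close> and \<open>Y\<close> together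
  cannot outweigh it.
\<close>

lemma ratio_condition_of_coeffs:
  assumes lam: "lam \<ge> 0" and par: "0 \<le> \<alpha>" "\<alpha> < 1" "0 \<le> k" "u > v"
    and nonneg: "\<And>n. p n \<ge> 0" "\<And>n. q n \<ge> 0" and "p 0 = 0" "q 0 < 1"
    and conv: "disc_convergent p" "disc_convergent q"
    and bound: "\<And>N. (\<Sum>n<N. ratio_weight k u v \<alpha> lam 1 n * p n
                         + ratio_weight k u v \<alpha> lam ((- 1) ^ (u + v)) n * q n) \<le> 1 - \<alpha>"
    and z: "norm z < 1" "z \<noteq> 0"
    and h: "\<And>z. z \<in> ball 0 1 \<Longrightarrow> h z = z - shifted_series p z"
    and g: "\<And>z. z \<in> ball 0 1 \<Longrightarrow> g z = (- 1) ^ (u - 1) * shifted_series q z"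
  shows "al_oboudi_harmonic lam v h g z \<noteq> 0"
    and "Re ((1 + of_real k * cis \<phi>) * (al_oboudi_harmonic lam u h g z / al_oboudi_harmonic lam v h g z)
              - of_real k * cis \<phi>) \<ge> \<alpha>"
proof -
  define U where "U = (\<lambda>n. (1 + real n * lam) ^ u)"
  define V where "V = (\<lambda>n. (1 + real n * lam) ^ v)"
  define s where "s = (- 1 :: real) ^ (u + v)"
  define A where "A = ratio_weight k u v \<alpha> lam 1"
  define B where "B = ratio_weight k u v \<alpha> lam s"
  have s: "\<bar>s\<bar> = 1" by (simp add: s_def power_abs)
  have UV: "1 \<le> V n" "V n \<le> U n" for n
    using power_weights[OF lam \<open>u > v\<close>] by (auto simp: U_def V_def)
  have A: "(1 - \<alpha>) * V n \<le> A n" and B: "(1 - \<alpha>) * V n \<le> B n" for n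
    using ratio_weight_ge[OF lam \<open>u > v\<close> par(1-3)] s by (auto simp: A_def B_def V_def)
  have V_pos: "(1 - \<alpha>) * V n > 0" for n
    using par UV(1)[of n] by (intro mult_pos_pos) auto
  have conv': "disc_convergent (\<lambda>n. U n * p n)" "disc_convergent (\<lambda>n. U n * q n)"
       "disc_convergent (\<lambda>n. V n * p n)" "disc_convergent (\<lambda>n. V n * q n)"
    using conv unfolding U_def V_def by (auto intro: disc_convergent_weighted)
  define P where "P = al_oboudi_harmonic lam u h g z"
  define Q where "Q = al_oboudi_harmonic lam v h g z"
  have P_eq: "P = z - shifted_series (\<lambda>n. U n * p n) z - cnj (shifted_series (\<lambda>n. U n * q n) z)"
    unfolding P_def U_def using al_oboudi_harmonic_neg[OF conv _ z(1) h g] par by simp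
  have Q_eq: "Q = z - shifted_series (\<lambda>n. V n * p n) z - of_real s * cnj (shifted_series (\<lambda>n. V n * q n) z)"
    unfolding Q_def V_def s_def using al_oboudi_harmonic_neg[OF conv _ z(1) h g] par by simp
  define d where "d = (\<lambda>n. A n * p n + B n * q n)"
  have d_nonneg: "d n \<ge> 0" for n
    unfolding d_def using A[of n] B[of n] V_pos[of n] nonneg by (intro add_nonneg_nonneg mult_nonneg_nonneg) auto
  have d_bound: "(\<Sum>n<N. d n) \<le> 1 - \<alpha>" for N
    using bound by (simp add: d_def A_def B_def s_def)

  show Q_nonzero: "al_oboudi_harmonic lam v h g z \<noteq> 0"
  proof -
    define S where "S = (\<lambda>c. \<Sum>n. \<bar>V n * c n\<bar> * norm z ^ n)"
    have "S p + S q = (\<Sum>n. \<bar>V n * p n\<bar> * norm z ^ n + \<bar>V n * q n\<bar> * norm z ^ n)"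
      unfolding S_def using conv' z by (intro suminf_add disc_convergentD) auto
    also have "\<dots> = (\<Sum>n. (V n * (p n + q n)) * norm z ^ n)"
      using nonneg order_trans[OF zero_le_one UV(1)] by (simp add: abs_mult algebra_simps)
    also have "\<dots> < 1"
    proof (rule power_series_less_one_of_partial_sums)
      fix N
      have "(1 - \<alpha>) * (\<Sum>n<N. V n * (p n + q n)) = (\<Sum>n<N. (1 - \<alpha>) * V n * p n + (1 - \<alpha>) * V n * q n)"
        by (simp add: sum_distrib_left algebra_simps)
      also have "\<dots> \<le> (\<Sum>n<N. d n)"
        unfolding d_def using A B nonneg by (intro sum_mono add_mono mult_right_mono) auto
      also have "\<dots> \<le> (1 - \<alpha>) * 1" using d_bound by simp
      finally show "(\<Sum>n<N. V n * (p n + q n)) \<le> 1"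
        using par by simp
    qed (use z nonneg \<open>p 0 = 0\<close> \<open>q 0 < 1\<close> order_trans[OF zero_le_one UV(1)] in \<open>auto simp: V_def\<close>)
    finally have less: "S p + S q < 1" .
    \<comment> \<open>The terms of Q other than z have total modulus less than that of z.\<close>
    have "norm (z - Q) = norm (shifted_series (\<lambda>n. V n * p n) z + of_real s * cnj (shifted_series (\<lambda>n. V n * q n) z))"
      by (simp add: Q_eq)
    also have "\<dots> \<le> norm (shifted_series (\<lambda>n. V n * p n) z) + norm (of_real s * cnj (shifted_series (\<lambda>n. V n * q n) z))"
      by (rule norm_triangle_ineq)
    also have "\<dots> = norm (shifted_series (\<lambda>n. V n * p n) z) + norm (shifted_series (\<lambda>n. V n * q n) z)"
      using s by (simp add: norm_mult)
    also have "\<dots> \<le> norm z * S p + norm z * S q"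
      unfolding S_def using conv' z by (intro add_mono norm_shifted_series_le)
    also have "\<dots> = norm z * (S p + S q)"
      by (simp add: algebra_simps)
    also have "\<dots> < norm z * 1"
      using less z by (intro mult_strict_left_mono) auto
    finally show ?thesis unfolding Q_def[symmetric] by auto
  qed

  define \<kappa> where "\<kappa> = of_real k * cis \<phi>"
  have \<kappa>: "norm \<kappa> = k" using par by (simp add: \<kappa>_def norm_mult)
  define x where "x = (\<lambda>n. of_real (p n) * z ^ (n + 1))"
  define y where "y = (\<lambda>n. cnj (of_real (q n) * z ^ (n + 1)))"
  have x: "(\<lambda>n. of_real (U n) * x n) sums shifted_series (\<lambda>n. U n * p n) z"
       "(\<lambda>n. of_real (V n) * x n) sums shifted_series (\<lambda>n. V n * p n) z"
    using conv'[THEN shifted_series_sums] z by (simp_all add: x_def mult.assoc)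
  have y: "(\<lambda>n. of_real (U n) * y n) sums cnj (shifted_series (\<lambda>n. U n * q n) z)"
       "(\<lambda>n. of_real (V n) * y n) sums cnj (shifted_series (\<lambda>n. V n * q n) z)"
    using conv'[THEN shifted_series_sums[THEN sums_cnj[THEN iffD2]]] z by (simp_all add: y_def mult.assoc)
  define \<xi> where "\<xi> = (\<lambda>\<sigma> n. (1 + \<kappa>) * of_real (U n) + (of_real (1 - 2 * \<alpha>) - \<kappa>) * of_real (\<sigma> * V n))"
  define \<eta> where "\<eta> = (\<lambda>\<sigma> n. (1 + \<kappa>) * of_real (U n - \<sigma> * V n))"
  define X where "X = (1 + \<kappa>) * P + (of_real (1 - 2 * \<alpha>) - \<kappa>) * Q"
  define Y where "Y = (1 + \<kappa>) * (P - Q)"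
  have zP: "(\<lambda>n. of_real (U n) * x n + of_real (U n) * y n) sums (z - P)"
    using sums_add[OF x(1) y(1)] by (simp add: P_eq)
  have zQ: "(\<lambda>n. of_real (V n) * x n + of_real s * (of_real (V n) * y n)) sums (z - Q)"
    using sums_add[OF x(2) sums_mult[OF y(2), of "of_real s"]] by (simp add: Q_eq)
  have "(\<lambda>n. \<xi> 1 n * x n + \<xi> s n * y n) sums (of_real (2 * (1 - \<alpha>)) * z - X)"
    using sums_add[OF sums_mult[OF zP, of "1 + \<kappa>"] sums_mult[OF zQ, of "of_real (1 - 2 * \<alpha>) - \<kappa>"]]
    by (simp add: \<xi>_def X_def algebra_simps)
  moreover have "(\<lambda>n. \<eta> 1 n * x n + \<eta> s n * y n) sums (- Y)"
    using sums_mult[OF sums_diff[OF zP zQ], of "1 + \<kappa>"]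
    by (simp add: \<eta>_def Y_def algebra_simps)
  moreover have "norm (\<xi> 1 n * x n + \<xi> s n * y n) + norm (\<eta> 1 n * x n + \<eta> s n * y n)
                   \<le> 2 * norm z * d n" for n
  proof -
    have nx: "norm (x n) = p n * norm z ^ (n + 1)" and ny: "norm (y n) = q n * norm z ^ (n + 1)"
      using nonneg by (simp_all add: x_def y_def norm_mult norm_power)
    have coeff: "norm (\<xi> \<sigma> n) + norm (\<eta> \<sigma> n) \<le> 2 * ratio_weight k u v \<alpha> lam \<sigma> n" if "\<bar>\<sigma>\<bar> = 1" for \<sigma>
      using norm_coeffs_le[OF \<kappa> par(1,2) _ _ that, of "V n" "U n"] UV[of n]
      unfolding \<xi>_def \<eta>_def ratio_weight_def U_def V_def by auto
    have "norm (\<xi> 1 n * x n + \<xi> s n * y n) + norm (\<eta> 1 n * x n + \<eta> s n * y n)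
            \<le> (norm (\<xi> 1 n * x n) + norm (\<xi> s n * y n)) + (norm (\<eta> 1 n * x n) + norm (\<eta> s n * y n))"
      by (intro add_mono norm_triangle_ineq)
    also have "\<dots> = (norm (\<xi> 1 n) + norm (\<eta> 1 n)) * norm (x n) + (norm (\<xi> s n) + norm (\<eta> s n)) * norm (y n)"
      by (simp add: norm_mult algebra_simps)
    also have "\<dots> \<le> 2 * A n * norm (x n) + 2 * B n * norm (y n)"
      unfolding A_def B_def using s by (intro add_mono mult_right_mono coeff) auto
    also have "\<dots> = 2 * norm z * (d n * norm z ^ n)"
      unfolding nx ny d_def by (simp add: algebra_simps)
    also have "\<dots> \<le> 2 * norm z * (d n * 1)"
      using d_nonneg z by (intro mult_left_mono power_le_one) auto
    finally show ?thesis by simp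
  qed
  moreover have "summable d"
    using d_nonneg d_bound by (rule summableI_nonneg_bounded)
  hence "(\<lambda>n. 2 * norm z * d n) sums (2 * norm z * suminf d)"
    by (intro sums_mult summable_sums)
  ultimately have "norm (of_real (2 * (1 - \<alpha>)) * z - X) + norm (- Y) \<le> 2 * norm z * suminf d"
    by (rule norm_sums_add_le)
  also have "\<dots> \<le> 2 * norm z * (1 - \<alpha>)"
    using \<open>summable d\<close> d_bound by (intro mult_left_mono suminf_le_const) auto
  also have "\<dots> = norm (complex_of_real (2 * (1 - \<alpha>)) * z)"
    using par by (simp only: norm_mult norm_of_real) simp
  also have "\<dots> \<le> norm (of_real (2 * (1 - \<alpha>)) * z - X) + norm X"
    using norm_triangle_ineq[of "of_real (2 * (1 - \<alpha>)) * z - X" X] by simp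
  finally have YX: "norm Y \<le> norm X" by simp
  define W where "W = (1 + \<kappa>) * (P / Q) - \<kappa>"
  have Q: "Q \<noteq> 0" using Q_nonzero by (simp add: Q_def)
  have "norm (W - 1) = norm Y / norm Q" "norm (W + of_real (1 - 2 * \<alpha>)) = norm X / norm Q"
    unfolding norm_divide[symmetric] W_def X_def Y_def using Q
    by (auto intro!: arg_cong[where f = norm] simp: field_simps)
  hence "norm (W - 1) \<le> norm (W + of_real (1 - 2 * \<alpha>))"
    using YX by (simp add: divide_right_mono)
  hence "Re W \<ge> \<alpha>"
    using Re_ge_iff_norm_le[OF par(2)] by blast
  thus "Re ((1 + of_real k * cis \<phi>) * (al_oboudi_harmonic lam u h g z / al_oboudi_harmonic lam v h g z)
              - of_real k * cis \<phi>) \<ge> \<alpha>"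
    by (simp add: W_def \<kappa>_def P_def Q_def)
qed

text \<open>
  At a positive real point the values of $D^u f$ and $D^v f$ are real, and $D^v f$ is positive because
  $D^v f(r)/r$ does not vanish and has a positive limit at 0, as $|b_1| < 1$.
  So the quotient can be multiplied out, and letting \<open>r\<close> tend to 1 gives the inequality.  The hypotheses refer to $\phi = 0$ only, where the condition is
  strongest at such points.
\<close>

lemma coeffs_of_ratio_condition:
  assumes lam: "lam \<ge> 0" and par: "0 \<le> \<alpha>" "\<alpha> < 1" "0 \<le> k" "u > v"
    and nonneg: "\<And>n. p n \<ge> 0" "\<And>n. q n \<ge> 0" and "p 0 = 0" "q 0 < 1"
    and conv: "disc_convergent p" "disc_convergent q"
    and h: "\<And>z. z \<in> ball 0 1 \<Longrightarrow> h z = z - shifted_series p z"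
    and g: "\<And>z. z \<in> ball 0 1 \<Longrightarrow> g z = (- 1) ^ (u - 1) * shifted_series q z"
    and nonzero: "\<And>r. 0 < r \<Longrightarrow> r < 1 \<Longrightarrow> al_oboudi_harmonic lam v h g (of_real r) \<noteq> 0"
    and Re: "\<And>r. 0 < r \<Longrightarrow> r < 1 \<Longrightarrow>
       Re ((1 + of_real k) * (al_oboudi_harmonic lam u h g (of_real r) / al_oboudi_harmonic lam v h g (of_real r))
            - of_real k) \<ge> \<alpha>"
  shows "(\<Sum>n<N. ratio_weight k u v \<alpha> lam 1 n * p n
                    + ratio_weight k u v \<alpha> lam ((- 1) ^ (u + v)) n * q n) \<le> 1 - \<alpha>"
proof -
  define U where "U = (\<lambda>n. (1 + real n * lam) ^ u)"
  define V where "V = (\<lambda>n. (1 + real n * lam) ^ v)"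
  define s where "s = (- 1 :: real) ^ (u + v)"
  have s: "\<bar>s\<bar> = 1" by (simp add: s_def power_abs)
  have conv': "disc_convergent (\<lambda>n. U n * p n)" "disc_convergent (\<lambda>n. U n * q n)"
       "disc_convergent (\<lambda>n. V n * p n)" "disc_convergent (\<lambda>n. V n * q n)"
    using conv unfolding U_def V_def by (auto intro: disc_convergent_weighted)
  have convU: "disc_convergent (\<lambda>n. U n * p n + U n * q n)"
    using conv' by (intro disc_convergent_add)
  have convV: "disc_convergent (\<lambda>n. V n * p n + s * (V n * q n))"
    using conv' by (intro disc_convergent_add disc_convergent_cmult)
  define P where "P = (\<lambda>r. \<Sum>n. (U n * p n + U n * q n) * r ^ n)"
  define Q where "Q = (\<lambda>r. \<Sum>n. (V n * p n + s * (V n * q n)) * r ^ n)"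
  have num: "al_oboudi_harmonic lam u h g (of_real r) = of_real (r * (1 - P r))"
    and den: "al_oboudi_harmonic lam v h g (of_real r) = of_real (r * (1 - Q r))" if r: "0 < r" "r < 1" for r
  proof -
    have r': "norm (complex_of_real r) < 1" "0 \<le> r" "u \<ge> 1" using that par by auto
    have real: "cnj (shifted_series c (of_real r)) = shifted_series c (of_real r)" if "disc_convergent c" for c
      using that r r' by (simp add: shifted_series_of_real)
    have "al_oboudi_harmonic lam u h g (of_real r) =
            of_real r - shifted_series (\<lambda>n. U n * p n + U n * q n) (of_real r)"
      using conv' r' by (subst al_oboudi_harmonic_neg[OF conv r'(3,1) h g])
        (auto simp: real shifted_series_add U_def)
    thus "al_oboudi_harmonic lam u h g (of_real r) = of_real (r * (1 - P r))"
      using shifted_series_of_real[OF convU, of r] r by (simp add: P_def algebra_simps)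
    have "al_oboudi_harmonic lam v h g (of_real r) =
            of_real r - shifted_series (\<lambda>n. V n * p n + s * (V n * q n)) (of_real r)"
      using conv' r' disc_convergent_cmult[OF conv'(4), of s]
      by (subst al_oboudi_harmonic_neg[OF conv r'(3,1) h g])
         (auto simp: real shifted_series_add shifted_series_cmult V_def s_def)
    thus "al_oboudi_harmonic lam v h g (of_real r) = of_real (r * (1 - Q r))"
      using shifted_series_of_real[OF convV, of r] r by (simp add: Q_def algebra_simps)
  qed
  have Q_less: "Q r < 1" if r: "0 < r" "r < 1" for r
    unfolding Q_def
  proof (rule power_series_less_one[OF convV])
    have "s * q 0 \<le> \<bar>s * q 0\<bar>" by simp
    also have "\<dots> < 1" using s nonneg(2)[of 0] \<open>q 0 < 1\<close> by (simp add: abs_mult)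
    finally show "V 0 * p 0 + s * (V 0 * q 0) < 1"
      using \<open>p 0 = 0\<close> by (simp add: V_def)
    fix t :: real assume t: "0 < t" "t < 1"
    show "(\<Sum>n. (V n * p n + s * (V n * q n)) * t ^ n) \<noteq> 1"
      using nonzero[OF t] den[OF t] by (auto simp: Q_def)
  qed (use r in auto)
  define d where "d = (\<lambda>n. (1 + k) * (U n * p n + U n * q n) + (- (k + \<alpha>)) * (V n * p n + s * (V n * q n)))"
  have d_eq: "d = (\<lambda>n. ratio_weight k u v \<alpha> lam 1 n * p n + ratio_weight k u v \<alpha> lam s n * q n)"
    by (auto simp: d_def ratio_weight_def U_def V_def algebra_simps)
  have "(\<Sum>n<N. d n) \<le> 1 - \<alpha>"
  proof (rule partial_sums_le_of_power_series_le)
    show "disc_convergent d"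
      unfolding d_def
      by (rule disc_convergent_add[OF disc_convergent_cmult disc_convergent_cmult, OF convU convV])
    show "d n \<ge> 0" for n
    proof -
      have "0 \<le> (1 - \<alpha>) * (1 + real n * lam) ^ v"
        using par lam by auto
      hence "0 \<le> ratio_weight k u v \<alpha> lam \<sigma> n" if "\<bar>\<sigma>\<bar> = 1" for \<sigma>
        using ratio_weight_ge[OF lam par(4,1-3) that, of n] by linarith
      thus ?thesis unfolding d_eq using s nonneg by auto
    qed
    fix r :: real assume r: "0 < r" "r < 1"
    have "\<alpha> \<le> (1 + k) * ((1 - P r) / (1 - Q r)) - k"
      using Re[OF r] r unfolding num[OF r] den[OF r] by (simp flip: of_real_divide of_real_mult of_real_diff)
    hence "(k + \<alpha>) * (1 - Q r) \<le> (1 + k) * (1 - P r)"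
      using Q_less[OF r] by (simp add: field_simps)
    moreover have "(\<lambda>n. (U n * p n + U n * q n) * r ^ n) sums P r"
        "(\<lambda>n. (V n * p n + s * (V n * q n)) * r ^ n) sums Q r"
      unfolding P_def Q_def using r convU convV
      by (auto intro!: summable_sums disc_convergent_real_summable simp del: distrib_right)
    hence "(\<lambda>n. (1 + k) * ((U n * p n + U n * q n) * r ^ n)
                + (- (k + \<alpha>)) * ((V n * p n + s * (V n * q n)) * r ^ n))
            sums ((1 + k) * P r + (- (k + \<alpha>)) * Q r)"
      by (intro sums_add sums_mult)
    hence "(\<lambda>n. d n * r ^ n) sums ((1 + k) * P r + (- (k + \<alpha>)) * Q r)"
      by (simp only: d_def distrib_right mult.assoc)
    ultimately show "(\<Sum>n. d n * r ^ n) \<le> 1 - \<alpha>"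
      by (simp add: sums_iff algebra_simps)
  qed
  thus ?thesis by (simp add: d_eq s_def)
qed

section \<open>Characterisation of the family by its coefficients\<close>

text \<open>
  The first family of inequalities expresses membership in \<^const>\<open>SH\<close>, the second one the ratio condition.
  Bounding all partial sums encodes convergence of the series together with the bound on its value.  The
  strict inequality \<open>q 0 < 1\<close> excludes $z \pm \overline{z}$, which satisfies the first family but is not injective.
\<close>

definition coeff_bounds ::
  "real \<Rightarrow> nat \<Rightarrow> nat \<Rightarrow> real \<Rightarrow> real \<Rightarrow> (nat \<Rightarrow> real) \<Rightarrow> (nat \<Rightarrow> real) \<Rightarrow> bool" where
  "coeff_bounds k u v \<alpha> lam p q \<longleftrightarrow>
     (\<forall>n. 0 \<le> p n) \<and> (\<forall>n. 0 \<le> q n) \<and> p 0 = 0 \<and> q 0 < 1 \<and>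
     (\<forall>N. (\<Sum>n<N. real (n + 1) * (p n + q n)) \<le> 1) \<and>
     (\<forall>N. (\<Sum>n<N. ratio_weight k u v \<alpha> lam 1 n * p n
                    + ratio_weight k u v \<alpha> lam ((- 1) ^ (u + v)) n * q n) \<le> 1 - \<alpha>)"

lemma coeff_bounds_le_one:
  assumes "coeff_bounds k u v \<alpha> lam p q"
  shows "\<bar>p n\<bar> \<le> 1" "\<bar>q n\<bar> \<le> 1"
proof -
  have pq: "p i \<ge> 0" "q i \<ge> 0" for i using assms by (auto simp: coeff_bounds_def)
  have "1 * (p n + q n) \<le> real (n + 1) * (p n + q n)"
    using pq[of n] by (intro mult_right_mono) auto
  also have "\<dots> \<le> (\<Sum>i<Suc n. real (i + 1) * (p i + q i))"
    using pq by (intro member_le_sum) auto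
  also have "\<dots> \<le> 1" using assms unfolding coeff_bounds_def by blast
  finally show "\<bar>p n\<bar> \<le> 1" "\<bar>q n\<bar> \<le> 1" using pq[of n] by auto
qed

lemma coeff_bounds_disc_convergent:
  assumes "coeff_bounds k u v \<alpha> lam p q"
  shows "disc_convergent p" "disc_convergent q"
  using coeff_bounds_le_one[OF assms] by (auto intro: disc_convergent_bounded)

lemma shifted_series_head:
  assumes "c 0 = 0" "disc_convergent c" "norm z < 1"
  shows "(\<lambda>n. of_real (c (n + 1)) * z ^ (n + 2)) sums shifted_series c z"
  using sums_Suc_iff[of "\<lambda>n. of_real (c n) * z ^ (n + 1)" "shifted_series c z"]
    shifted_series_sums[OF assms(2,3)] assms(1) by simp

text \<open>
  Together with the converse below this characterises the family by inequalities that are linear in the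
  coefficient moduli.
\<close>

lemma k_UTH_imp_coeff_bounds:
  assumes par: "lam \<ge> 0" "0 \<le> \<alpha>" "\<alpha> < 1" "0 \<le> k" "u > v"
    and f: "f \<in> k_UTH k u v \<alpha> lam"
  obtains p q where "coeff_bounds k u v \<alpha> lam p q"
    "\<And>z. z \<in> ball 0 1 \<Longrightarrow> f z = neg_harmonic u p q z"
proof -
  from f obtain h g and a b :: "nat \<Rightarrow> complex" where
    decomp: "harmonic_decomp f h g" and "cmod (b 1) < 1" and
    hg: "\<forall>z\<in>ball 0 1.
              summable (\<lambda>n. of_real (cmod (a (n + 2))) * z ^ (n + 2)) \<and>
              h z = z - (\<Sum>n. of_real (cmod (a (n + 2))) * z ^ (n + 2)) \<and>
              summable (\<lambda>n. of_real (cmod (b (n + 1))) * z ^ (n + 1)) \<and>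
              g z = (-1) ^ (u - 1) * (\<Sum>n. of_real (cmod (b (n + 1))) * z ^ (n + 1))"
    unfolding k_UTH_def by (elim CollectE conjE exE) (rule that)
  \<comment> \<open>The shift by one is due to index n standing for the power n + 1.\<close>
  define p where "p = (\<lambda>n. if n = 0 then 0 else cmod (a (n + 1)))"
  define q where "q = (\<lambda>n. cmod (b (n + 1)))"
  have nonneg: "p n \<ge> 0" "q n \<ge> 0" for n by (auto simp: p_def q_def)
  have p0: "p 0 = 0" and q0: "q 0 < 1" using \<open>cmod (b 1) < 1\<close> by (auto simp: p_def q_def)
  have p_Suc: "cmod (a (n + 2)) = p (n + 1)" for n by (simp add: p_def)
  have conv: "disc_convergent p" "disc_convergent q"
  proof -
    have "summable (\<lambda>n. of_real (p n) * z ^ (n + 1))" if "norm z < 1" for z :: complex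
      using bspec[OF hg, of z] that summable_Suc_iff[of "\<lambda>n. of_real (p n) * z ^ (n + 1)"]
      unfolding p_Suc by simp
    thus "disc_convergent p" using nonneg by (intro disc_convergentI_complex)
    have "summable (\<lambda>n. of_real (q n) * z ^ (n + 1))" if "norm z < 1" for z :: complex
      using bspec[OF hg, of z] that by (simp add: q_def)
    thus "disc_convergent q" using nonneg by (intro disc_convergentI_complex)
  qed
  have h: "h z = z - shifted_series p z" and g: "g z = (-1) ^ (u - 1) * shifted_series q z"
    if "z \<in> ball 0 1" for z
    using bspec[OF hg that, unfolded p_Suc] shifted_series_head[OF p0 conv(1), of z] that
    by (simp_all add: sums_iff shifted_series_def q_def)
  have f_eq: "f z = neg_harmonic u p q z" if "z \<in> ball 0 1" for z
    using decomp h[OF that] g[OF that] that by (simp add: harmonic_decomp_def neg_harmonic_def)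

  from f have USH: "f \<in> k_USH k u v \<alpha> lam" by (simp add: k_UTH_def)
  hence SH: "f \<in> SH" by (simp add: k_USH_def)
  from USH obtain h' g' where decomp': "harmonic_decomp f h' g'" and
    ratio: "\<forall>z\<in>ball 0 1 - {0}. al_oboudi_harmonic lam v h' g' z \<noteq> 0 \<and>
           (\<forall>\<phi>::real. Re ((1 + of_real k * cis \<phi>) *
                    (al_oboudi_harmonic lam u h' g' z / al_oboudi_harmonic lam v h' g' z)
                  - of_real k * cis \<phi>) \<ge> \<alpha>)"
    unfolding k_USH_def by (elim CollectE conjE exE) (rule that)
  note h' = harmonic_decomp_unique[OF decomp' decomp]
  have "(\<Sum>n<N. ratio_weight k u v \<alpha> lam 1 n * p n
                    + ratio_weight k u v \<alpha> lam ((- 1) ^ (u + v)) n * q n) \<le> 1 - \<alpha>" for N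
  proof (rule coeffs_of_ratio_condition[where h = h' and g = g'])
    fix r :: real assume r: "0 < r" "r < 1"
    hence r': "complex_of_real r \<in> ball 0 1 - {0}" by simp
    show "al_oboudi_harmonic lam v h' g' (of_real r) \<noteq> 0"
      using bspec[OF ratio r'] by (rule conjunct1)
    show "Re ((1 + of_real k) * (al_oboudi_harmonic lam u h' g' (of_real r) / al_oboudi_harmonic lam v h' g' (of_real r))
            - of_real k) \<ge> \<alpha>"
      using bspec[OF ratio r', THEN conjunct2, THEN spec, of 0] by simp
  qed (use par nonneg p0 q0 conv h g h' in simp_all)
  moreover have "(\<Sum>n<N. real (n + 1) * (p n + q n)) \<le> 1" for N
    using nonneg p0 conv f_eq SH by (rule SH_neg_harmonic_partial_sums)
  ultimately have "coeff_bounds k u v \<alpha> lam p q"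
    unfolding coeff_bounds_def using nonneg p0 q0 by auto
  thus thesis using f_eq that by blast
qed

lemma coeff_bounds_imp_k_UTH:
  assumes par: "lam \<ge> 0" "0 \<le> \<alpha>" "\<alpha> < 1" "0 \<le> k" "u > v"
    and bounds: "coeff_bounds k u v \<alpha> lam p q"
    and f: "\<And>z. z \<in> ball 0 1 \<Longrightarrow> f z = neg_harmonic u p q z"
  shows "f \<in> k_UTH k u v \<alpha> lam"
proof -
  note conv = coeff_bounds_disc_convergent[OF bounds]
  have nonneg: "p n \<ge> 0" "q n \<ge> 0" and p0: "p 0 = 0" and q0: "q 0 < 1"
    and SH_bound: "(\<Sum>n<N. real (n + 1) * (p n + q n)) \<le> 1"
    and ratio_bound: "(\<Sum>n<N. ratio_weight k u v \<alpha> lam 1 n * p n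
                    + ratio_weight k u v \<alpha> lam ((- 1) ^ (u + v)) n * q n) \<le> 1 - \<alpha>" for n N
    using bounds by (auto simp: coeff_bounds_def)
  define h where "h = (\<lambda>z. z - shifted_series p z)"
  define g where "g = (\<lambda>z. (- 1) ^ (u - 1) * shifted_series q z)"
  have decomp: "harmonic_decomp f h g"
    unfolding h_def g_def using conv f by (rule neg_harmonic_decomp)
  have SH: "f \<in> SH"
    using nonneg p0 q0 SH_bound conv f by (rule neg_harmonic_in_SH)
  have USH: "f \<in> k_USH k u v \<alpha> lam"
  proof -
    have "al_oboudi_harmonic lam v h g z \<noteq> 0"
      and "Re ((1 + of_real k * cis \<phi>) * (al_oboudi_harmonic lam u h g z / al_oboudi_harmonic lam v h g z)
              - of_real k * cis \<phi>) \<ge> \<alpha>" if "z \<in> ball 0 1 - {0}" for z \<phi>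
      using ratio_condition_of_coeffs[OF par nonneg p0 q0 conv ratio_bound, of z h g] that
      by (simp_all add: h_def g_def)
    thus ?thesis using SH decomp unfolding k_USH_def by blast
  qed
  define a where "a = (\<lambda>n. complex_of_real (p (n - 1)))"
  define b where "b = (\<lambda>n. complex_of_real (q (n - 1)))"
  have "cmod (b 1) < 1" using nonneg(2)[of 0] q0 by (simp add: b_def)
  moreover have "\<forall>z\<in>ball 0 1.
              summable (\<lambda>n. of_real (cmod (a (n + 2))) * z ^ (n + 2)) \<and>
              h z = z - (\<Sum>n. of_real (cmod (a (n + 2))) * z ^ (n + 2)) \<and>
              summable (\<lambda>n. of_real (cmod (b (n + 1))) * z ^ (n + 1)) \<and>
              g z = (-1) ^ (u - 1) * (\<Sum>n. of_real (cmod (b (n + 1))) * z ^ (n + 1))"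
  proof
    fix z :: complex assume "z \<in> ball 0 1"
    hence z: "norm z < 1" by simp
    show "summable (\<lambda>n. of_real (cmod (a (n + 2))) * z ^ (n + 2)) \<and>
              h z = z - (\<Sum>n. of_real (cmod (a (n + 2))) * z ^ (n + 2)) \<and>
              summable (\<lambda>n. of_real (cmod (b (n + 1))) * z ^ (n + 1)) \<and>
              g z = (-1) ^ (u - 1) * (\<Sum>n. of_real (cmod (b (n + 1))) * z ^ (n + 1))"
      using shifted_series_head[OF p0 conv(1) z] shifted_series_sums[OF conv(2) z] nonneg
      by (simp add: sums_iff a_def b_def h_def g_def)
  qed
  ultimately show ?thesis
    using USH decomp unfolding k_UTH_def by blast
qed

section \<open>Convex combinations\<close>

lemma convex_sum_le:
  fixes t x :: "nat \<Rightarrow> real"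
  assumes "t sums 1" "\<And>j. t j \<ge> 0" "\<And>j. x j \<le> C" "summable (\<lambda>j. t j * x j)"
  shows "(\<Sum>j. t j * x j) \<le> C"
proof -
  have "(\<Sum>j. t j * x j) \<le> (\<Sum>j. t j * C)"
    using assms sums_mult2[OF assms(1), of C] by (intro suminf_le mult_left_mono) (auto simp: sums_iff)
  thus ?thesis using sums_mult2[OF assms(1), of C] by (simp add: sums_iff)
qed

text \<open>
  The inequality stays strict for infinitely many summands because the defects \<open>t j * (C - x j)\<close> are
  non-negative and at least one weight is positive.
\<close>

lemma convex_sum_less:
  fixes t x :: "nat \<Rightarrow> real"
  assumes "t sums 1" "\<And>j. t j \<ge> 0" "\<And>j. x j < C" "summable (\<lambda>j. t j * x j)"
  shows "(\<Sum>j. t j * x j) < C"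
proof -
  have "\<exists>j. t j > 0"
    using suminf_pos_iff[of t] assms(1,2) by (auto simp: sums_iff)
  then obtain j where j: "t j > 0" by blast
  have diff: "(\<lambda>j. t j * (C - x j)) sums (C - (\<Sum>j. t j * x j))"
    using sums_diff[OF sums_mult2[OF assms(1), of C] summable_sums[OF assms(4)]]
    by (simp add: algebra_simps)
  have "0 < (\<Sum>j. t j * (C - x j))"
    by (rule suminf_pos2[where i = j]) (use diff j assms(2,3) in \<open>auto simp: sums_iff less_imp_le\<close>)
  thus ?thesis using diff by (simp add: sums_iff)
qed

lemma convex_summable:
  fixes t x :: "nat \<Rightarrow> real"
  assumes "t sums 1" "\<And>j. t j \<ge> 0" "\<And>j. \<bar>x j\<bar> \<le> 1"
  shows "summable (\<lambda>j. t j * x j)"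
  by (rule summable_comparison_test'[of t 0])
     (use assms in \<open>auto simp: sums_iff abs_mult intro!: mult_left_le\<close>)

text \<open>
  The two summations may be exchanged: the partial sums over \<open>j\<close> of the coefficients are bounded by 1,
  so the geometric series dominates and Tannery's theorem applies.
\<close>

lemma shifted_series_convex_sums:
  fixes t :: "nat \<Rightarrow> real" and p :: "nat \<Rightarrow> nat \<Rightarrow> real"
  assumes t: "t sums 1" "\<And>j. t j \<ge> 0" and p: "\<And>j n. \<bar>p j n\<bar> \<le> 1" and z: "norm z < 1"
  shows "(\<lambda>j. of_real (t j) * shifted_series (p j) z) sums shifted_series (\<lambda>n. \<Sum>j. t j * p j n) z"
proof -
  define a where "a = (\<lambda>n J. complex_of_real (\<Sum>j<J. t j * p j n) * z ^ (n + 1))"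
  have "(\<lambda>J. \<Sum>n. a n J) \<longlonglongrightarrow> (\<Sum>n. of_real (\<Sum>j. t j * p j n) * z ^ (n + 1))"
  proof (rule tannerys_theorem[THEN conjunct2, THEN conjunct2])
    show "(\<lambda>J. a n J) \<longlonglongrightarrow> of_real (\<Sum>j. t j * p j n) * z ^ (n + 1)" for n
      unfolding a_def
      by (intro tendsto_intros summable_LIMSEQ convex_summable t p)
    have "norm (a n J) \<le> norm z ^ (n + 1)" for n J
    proof -
      have "\<bar>\<Sum>j<J. t j * p j n\<bar> \<le> (\<Sum>j<J. \<bar>t j * p j n\<bar>)" by (rule sum_abs)
      also have "\<dots> \<le> (\<Sum>j<J. t j)"
        using t p by (intro sum_mono) (auto simp: abs_mult intro!: mult_left_le)
      also have "\<dots> \<le> suminf t"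
        using t by (intro sum_le_suminf) (auto simp: sums_iff)
      finally have "\<bar>\<Sum>j<J. t j * p j n\<bar> \<le> 1" using t by (simp add: sums_iff)
      thus ?thesis unfolding a_def norm_mult norm_power norm_of_real
        using mult_right_mono[of "\<bar>\<Sum>j<J. t j * p j n\<bar>" 1 "norm z ^ (n + 1)"] by simp
    qed
    thus "\<forall>\<^sub>F (n, J) in sequentially \<times>\<^sub>F sequentially. norm (a n J) \<le> norm z ^ (n + 1)"
      by (simp add: case_prod_unfold)
    show "summable (\<lambda>n. norm z ^ (n + 1))"
      using z by (simp add: summable_mult summable_geometric)
  qed auto
  moreover have "(\<Sum>n. a n J) = (\<Sum>j<J. of_real (t j) * shifted_series (p j) z)" for J
  proof -
    have "(\<lambda>n. of_real (p j n) * z ^ (n + 1)) sums shifted_series (p j) z" for j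
      using p z by (intro shifted_series_sums disc_convergent_bounded)
    hence "(\<lambda>n. \<Sum>j<J. of_real (t j) * (of_real (p j n) * z ^ (n + 1))) sums
            (\<Sum>j<J. of_real (t j) * shifted_series (p j) z)"
      by (intro sums_sum sums_mult)
    thus ?thesis
      by (simp add: a_def sums_iff sum_distrib_right mult.assoc)
  qed
  ultimately show ?thesis
    by (simp add: sums_def shifted_series_def)
qed

lemma neg_harmonic_convex_sums:
  fixes t :: "nat \<Rightarrow> real"
  assumes t: "t sums 1" "\<And>j. t j \<ge> 0" and pq: "\<And>j n. \<bar>p j n\<bar> \<le> 1" "\<And>j n. \<bar>q j n\<bar> \<le> 1"
    and z: "norm z < 1"
  shows "(\<lambda>j. of_real (t j) * neg_harmonic u (p j) (q j) z) sums
           neg_harmonic u (\<lambda>n. \<Sum>j. t j * p j n) (\<lambda>n. \<Sum>j. t j * q j n) z"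
proof -
  have identity: "(\<lambda>j. of_real (t j) * z) sums z"
    using sums_mult2[OF sums_of_real[OF t(1)], of z] by simp
  have analytic: "(\<lambda>j. of_real (t j) * shifted_series (p j) z) sums
                    shifted_series (\<lambda>n. \<Sum>j. t j * p j n) z"
    using t pq(1) z by (rule shifted_series_convex_sums)
  have "(\<lambda>j. of_real (t j) * shifted_series (q j) z) sums
          shifted_series (\<lambda>n. \<Sum>j. t j * q j n) z"
    using t pq(2) z by (rule shifted_series_convex_sums)
  from this[THEN sums_cnj[THEN iffD2]]
  have coanalytic: "(\<lambda>j. of_real (t j) * cnj (shifted_series (q j) z)) sums
                      cnj (shifted_series (\<lambda>n. \<Sum>j. t j * q j n) z)"
    by simp
  show ?thesis
    using sums_add[OF sums_diff[OF identity analytic] sums_mult[OF coanalytic, of "(- 1) ^ (u - 1)"]]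
    by (simp add: neg_harmonic_def algebra_simps)
qed

text \<open>
  Each of the two families of inequalities bounds a finite linear combination of the coefficient moduli from above, and such a
  bound survives averaging with the weights \<open>t\<close>.
\<close>

lemma coeff_bounds_convex:
  fixes t :: "nat \<Rightarrow> real"
  assumes t: "t sums 1" "\<And>j. t j \<ge> 0"
    and bounds: "\<And>j. coeff_bounds k u v \<alpha> lam (p j) (q j)"
  shows "coeff_bounds k u v \<alpha> lam (\<lambda>n. \<Sum>j. t j * p j n) (\<lambda>n. \<Sum>j. t j * q j n)"
proof -
  have nonneg: "p j n \<ge> 0" "q j n \<ge> 0" and zero: "p j 0 = 0" "q j 0 < 1" for j n
    using bounds[of j] by (auto simp: coeff_bounds_def)
  have summ: "summable (\<lambda>j. t j * p j n)" "summable (\<lambda>j. t j * q j n)" for n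
    using coeff_bounds_le_one[OF bounds] by (auto intro!: convex_summable t)
  have linear: "(\<Sum>n<N. x n * (\<Sum>j. t j * p j n) + y n * (\<Sum>j. t j * q j n)) \<le> C"
    if le: "\<And>j. (\<Sum>n<N. x n * p j n + y n * q j n) \<le> C" for x y :: "nat \<Rightarrow> real" and N C
  proof -
    have "(\<lambda>j. \<Sum>n<N. x n * (t j * p j n) + y n * (t j * q j n)) sums
            (\<Sum>n<N. x n * (\<Sum>j. t j * p j n) + y n * (\<Sum>j. t j * q j n))"
      by (intro sums_sum sums_add sums_mult summable_sums summ)
    moreover have "(\<Sum>n<N. x n * (t j * p j n) + y n * (t j * q j n)) =
                     t j * (\<Sum>n<N. x n * p j n + y n * q j n)" for j
      by (simp add: sum_distrib_left algebra_simps)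
    ultimately have sums: "(\<lambda>j. t j * (\<Sum>n<N. x n * p j n + y n * q j n)) sums
            (\<Sum>n<N. x n * (\<Sum>j. t j * p j n) + y n * (\<Sum>j. t j * q j n))"
      by simp
    show ?thesis
      using convex_sum_le[OF t le sums_summable[OF sums]] sums by (simp add: sums_iff)
  qed
  show ?thesis
    unfolding coeff_bounds_def
  proof (intro conjI allI)
    fix N
    show "(\<Sum>n<N. real (n + 1) * ((\<Sum>j. t j * p j n) + (\<Sum>j. t j * q j n))) \<le> 1"
      using linear[where x = "\<lambda>n. real (n + 1)" and y = "\<lambda>n. real (n + 1)" and C = 1 and N = N] bounds
      by (simp only: coeff_bounds_def distrib_left)
    show "(\<Sum>n<N. ratio_weight k u v \<alpha> lam 1 n * (\<Sum>j. t j * p j n)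
            + ratio_weight k u v \<alpha> lam ((- 1) ^ (u + v)) n * (\<Sum>j. t j * q j n)) \<le> 1 - \<alpha>"
      using bounds by (intro linear) (simp add: coeff_bounds_def)
  qed (use summ t nonneg zero in \<open>auto intro!: suminf_nonneg convex_sum_less\<close>)
qed

theorem theorem2p6:
  fixes lam \<alpha> k :: real and u v :: nat
    and f :: "nat \<Rightarrow> complex \<Rightarrow> complex" and t :: "nat \<Rightarrow> real"
  assumes "lam \<ge> 0" and "0 \<le> \<alpha>" and "\<alpha> < 1" and "0 \<le> k"
    and "u \<ge> 1" and "u > v"
    and "\<And>j. j \<ge> 1 \<Longrightarrow> f j \<in> k_UTH k u v \<alpha> lam"
    and "\<And>j. j \<ge> 1 \<Longrightarrow> 0 \<le> t j \<and> t j \<le> 1"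
    and "(\<lambda>j. t (j + 1)) sums 1"
  shows "(\<forall>z\<in>ball 0 1. summable (\<lambda>j. of_real (t (j + 1)) * f (j + 1) z)) \<and>
         (\<lambda>z. \<Sum>j. of_real (t (j + 1)) * f (j + 1) z) \<in> k_UTH k u v \<alpha> lam"
proof -
  have "\<exists>p q. coeff_bounds k u v \<alpha> lam p q \<and>
               (\<forall>z\<in>ball 0 1. f (j + 1) z = neg_harmonic u p q z)" for j
    by (rule k_UTH_imp_coeff_bounds[of lam \<alpha> k v u "f (j + 1)"]) (use assms in auto)
  then obtain p q where bounds: "\<And>j. coeff_bounds k u v \<alpha> lam (p j) (q j)"
    and f_eq: "\<And>j z. z \<in> ball 0 1 \<Longrightarrow> f (j + 1) z = neg_harmonic u (p j) (q j) z"
    by metis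
  have t: "t (j + 1) \<ge> 0" for j using assms(8)[of "j + 1"] by simp
  define P where "P = (\<lambda>n. \<Sum>j. t (j + 1) * p j n)"
  define Q where "Q = (\<lambda>n. \<Sum>j. t (j + 1) * q j n)"
  have sums: "(\<lambda>j. of_real (t (j + 1)) * f (j + 1) z) sums neg_harmonic u P Q z"
    if "z \<in> ball 0 1" for z
    using neg_harmonic_convex_sums[of _ p q z u, OF assms(9) t coeff_bounds_le_one[OF bounds]] that
    unfolding f_eq[OF that] P_def Q_def by simp
  have "coeff_bounds k u v \<alpha> lam P Q"
    unfolding P_def Q_def using assms(9) t bounds by (rule coeff_bounds_convex)
  hence "(\<lambda>z. \<Sum>j. of_real (t (j + 1)) * f (j + 1) z) \<in> k_UTH k u v \<alpha> lam"
    using assms(1-4,6) sums by (intro coeff_bounds_imp_k_UTH[where p = P and q = Q]) (auto simp: sums_iff)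
  thus ?thesis using sums sums_summable by blast
qed

end
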